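(* Let $\tau>0$, let $U\subseteq\mathbb{R}^m$ be nonempty, let $f\colon\mathbb{R}^n\times U\to\mathbb{R}^n$ be such that $f(\cdot,u)$ is locally Lipschitz for all $u\in U$, and let $W=\llbracket-w,w\rrbracket$ for some $w\in\mathbb{R}^n_+$; consider the perturbed control system $\dot x\in f(x,u)+W$. Let $U'\subseteq U$ and assume in addition that $f(\cdot,u)$ is continuously differentiable for every $u\in U'$. Furthermore, let $K\subseteq K'\subseteq\mathbb{R}^n$ with $K'$ convex, such that for any $u\in U'$, any $\tau'\in[0,\tau]$ and any solution $\xi$ on $[0,\tau']$ of $\dot x\in f(x,u)+W$ with input $u$ and $\xi(0)\in K$, we have $\xi(t)\in K'$ for all $t\in[0,\tau']$. Lastly, let the parametrized matrix $L\colon U'\to\mathbb{R}^{n\times n}$ satisfy $$L_{i,j}(u)\ge\begin{cases}D_jf_i(x,u),&\text{if } i=j,\\ |D_jf_i(x,u)|,&\text{otherwise}\end{cases}$$ for all $x\in K'$ and all $u\in U'$. Then any such solution $\xi$ is continuable to $[0,\tau]$, and the map $\beta$ given by $$\beta(r,u)=\mathrm{e}^{L(u)\tau}\,r+\int_0^\tau\mathrm{e}^{L(u)s}\,w\,\mathrm{d}s$$ is a growth bound on $K$, $U'$ associated with $\tau$ and $\dot x\in f(x,u)+W$.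
   Context: Notation. $\mathbb{R}_+=[0,\infty[$. For vectors, $\le,\ge$ and $|\cdot|$ are understood component-wise. $\llbracket a,b\rrbracket=[a_1,b_1]\times\cdots\times[a_n,b_n]$ for $a\le b$ in $\mathbb{R}^n$. $D_jf_i$ denotes the partial derivative of $f_i$ with respect to the $j$th component of the first argument. Solutions. For an interval $I\subseteq[0,\tau]$, a solution of $\dot x\in f(x,u)+W$ on $I$ with (constant) input $u\in U$ is an absolutely continuous $\xi\colon I\to\mathbb{R}^n$ with $\dot\xi(t)\in f(\xi(t),u)+W$ for almost every $t\in I$. Such a $\xi$ is continuable to $[0,\tau]$ if there exists a solution $\bar\xi$ of $\dot x\in f(x,u)+W$ on $[0,\tau]$ with input $u$ such that $\bar\xi|_I=\xi$. $\varphi$ denotes the general solution of the unperturbed system: $\varphi(\cdot,x_0,u)$ is the unique non-continuable solution of $\dot x=f(x,u)$, $x(0)=x_0$. Growth bound. For $K\subseteq\mathbb{R}^n$, $U'\subseteq U$, a map $\beta\colon\mathbb{R}_+^n\times U'\to\mathbb{R}_+^n$ is a growth bound on $K$, $U'$ associated with $\tau$ and $\dot x\in f(x,u)+W$ if: (1) $\beta(r,u)\ge\beta(r',u)$ whenever $r\ge r'$ and $u\in U'$; (2) $[0,\tau]\times K\times U'\subseteq\operatorname{dom}\varphi$, and if $\xi$ is a solution of $\dot x\in f(x,u)+W$ on $[0,\tau]$ with input $u\in U'$ and $\xi(0),p\in K$, then $|\xi(\tau)-\varphi(\tau,p,u)|\le\beta(|\xi(0)-p|,u)$ component-wise.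
   Formalization: The set K' is additionally assumed nonempty; for K = K' = ∅ the condition on L is vacuous, so L(u) may have negative off-diagonal entries and β need not be nonnegative or monotone. *)

theory Defs
  imports "HOL-Analysis.Analysis"
begin

text \<open>
  Absolute continuity on every compact subinterval of the interval \<open>I\<close>. For compact \<open>I\<close> this is plain
  absolute continuity; the local form is needed on the half-open or open intervals on which maximal
  solutions live, where a solution may be unbounded.
\<close>

definition abs_continuous_on :: "real set \<Rightarrow> (real \<Rightarrow> 'a::real_normed_vector) \<Rightarrow> bool" where
  "abs_continuous_on S \<xi> \<longleftrightarrow>
     (\<forall>\<epsilon>>0. \<exists>\<delta>>0. \<forall>d T. d division_of T \<and> T \<subseteq> S \<and> (\<Sum>k\<in>d. Sup k - Inf k) < \<delta> \<longrightarrow>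
        (\<Sum>k\<in>d. norm (\<xi> (Sup k) - \<xi> (Inf k))) < \<epsilon>)"

definition loc_abs_continuous_on :: "real set \<Rightarrow> (real \<Rightarrow> 'a::real_normed_vector) \<Rightarrow> bool" where
  "loc_abs_continuous_on I \<xi> \<longleftrightarrow> (\<forall>a b. {a..b} \<subseteq> I \<longrightarrow> abs_continuous_on {a..b} \<xi>)"

text \<open>
  Solutions of \<open>x' \<in> f(x,u) + W\<close> on the interval \<open>I\<close> with constant input \<open>u\<close>. They are total functions
  of which only the values on \<open>I\<close> matter.
\<close>

definition solution_on ::
  "(real^'n \<Rightarrow> real^'m \<Rightarrow> real^'n) \<Rightarrow> (real^'n) set \<Rightarrow> real^'m \<Rightarrow> real set \<Rightarrow> (real \<Rightarrow> real^'n) \<Rightarrow> bool"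
where
  "solution_on f W u I \<xi> \<longleftrightarrow>
     is_interval I \<and> loc_abs_continuous_on I \<xi> \<and>
     (AE t\<in>I in lebesgue.
        \<exists>v. (\<xi> has_vector_derivative v) (at t within I) \<and> v \<in> (+) (f (\<xi> t) u) ` W)"

definition continuable_to ::
  "(real^'n \<Rightarrow> real^'m \<Rightarrow> real^'n) \<Rightarrow> (real^'n) set \<Rightarrow> real^'m \<Rightarrow> real set \<Rightarrow> (real \<Rightarrow> real^'n) \<Rightarrow>
    real set \<Rightarrow> bool"
where
  "continuable_to f W u I \<xi> J \<longleftrightarrow> (\<exists>\<eta>. solution_on f W u J \<eta> \<and> (\<forall>t\<in>I. \<eta> t = \<xi> t))"

definition noncontinuable_solution ::
  "(real^'n \<Rightarrow> real^'m \<Rightarrow> real^'n) \<Rightarrow> real^'m \<Rightarrow> real^'n \<Rightarrow> real set \<Rightarrow> (real \<Rightarrow> real^'n) \<Rightarrow> bool"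
where
  "noncontinuable_solution f u p I \<xi> \<longleftrightarrow>
     solution_on f {0} u I \<xi> \<and> 0 \<in> I \<and> \<xi> 0 = p \<and>
     (\<forall>J. is_interval J \<and> I \<subset> J \<longrightarrow> \<not> continuable_to f {0} u I \<xi> J)"

text \<open>
  \<open>general_solution f u p\<close> is the map \<open>t \<mapsto> \<phi>(t,p,u)\<close>; its partiality records \<open>dom \<phi>\<close>.
  It is meaningful when \<open>f(\<cdot>,u)\<close> is locally Lipschitz, so that the description below is unique.
\<close>

definition general_solution ::
  "(real^'n \<Rightarrow> real^'m \<Rightarrow> real^'n) \<Rightarrow> real^'m \<Rightarrow> real^'n \<Rightarrow> (real \<rightharpoonup> real^'n)"
where
  "general_solution f u p = (THE g. noncontinuable_solution f u p (dom g) (\<lambda>t. the (g t)))"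

text \<open>
  Order and absolute value on \<open>real^'n\<close> are component-wise. The first conjunct says that \<open>\<beta>\<close> maps
  into the nonnegative orthant.
\<close>

definition growth_bound ::
  "real \<Rightarrow> (real^'n \<Rightarrow> real^'m \<Rightarrow> real^'n) \<Rightarrow> (real^'n) set \<Rightarrow> (real^'n) set \<Rightarrow> (real^'m) set \<Rightarrow>
    (real^'n \<Rightarrow> real^'m \<Rightarrow> real^'n) \<Rightarrow> bool"
where
  "growth_bound \<tau> f W K U' \<beta> \<longleftrightarrow>
     (\<forall>u\<in>U'. \<forall>r\<ge>0. \<beta> r u \<ge> 0) \<and>
     (\<forall>u\<in>U'. \<forall>r'\<ge>0. \<forall>r\<ge>r'. \<beta> r u \<ge> \<beta> r' u) \<and>
     (\<forall>u\<in>U'. \<forall>p\<in>K. {0..\<tau>} \<subseteq> dom (general_solution f u p)) \<and>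
     (\<forall>u\<in>U'. \<forall>\<xi>. \<forall>p\<in>K. solution_on f W u {0..\<tau>} \<xi> \<and> \<xi> 0 \<in> K \<longrightarrow>
        \<bar>\<xi> \<tau> - the (general_solution f u p \<tau>)\<bar> \<le> \<beta> \<bar>\<xi> 0 - p\<bar> u)"

definition continuously_differentiable ::
  "('a::real_normed_vector \<Rightarrow> 'b::real_normed_vector) \<Rightarrow> bool"
where
  "continuously_differentiable g \<longleftrightarrow>
     (\<exists>g' :: 'a \<Rightarrow> 'a \<Rightarrow>\<^sub>L 'b.
        (\<forall>x. (g has_derivative blinfun_apply (g' x)) (at x)) \<and> continuous_on UNIV g')"

definition partial_deriv :: "'n \<Rightarrow> (real^'n \<Rightarrow> real) \<Rightarrow> real^'n \<Rightarrow> real" where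
  "partial_deriv j g x = deriv (\<lambda>h. g (x + h *\<^sub>R axis j 1)) 0"

text \<open>
  The multiplication of the type \<open>real^'n^'n\<close> is component-wise, so matrix powers are iterates of \<open>(**)\<close>.
\<close>

definition matrix_exp :: "real^'n^'n \<Rightarrow> real^'n^'n" where
  "matrix_exp A = (\<Sum>k. (1 / fact k) *\<^sub>R (((**) A ^^ k) (mat 1)))"

end

theory Submission
  imports Defs
begin

text \<open>
  Fix \<open>u\<close> and write \<open>A = L(u)\<close>. Let \<open>\<xi>\<close> be a perturbed and \<open>\<eta>\<close> an unperturbed solution that
  start in \<open>K\<close>, and let \<open>z = \<xi> - \<eta>\<close>. Both stay in the convex set \<open>K'\<close>, so the mean value theorem on the
  segment between them turns the bounds on the partial derivatives into
  \<open>sgn(z_i) (f(\<xi>,u) - f(\<eta>,u))_i \<le> (A|z|)_i\<close> (\<open>one_sided_estimate\<close>). The upper bound on the diagonal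
  entries suffices because \<open>z_i\<close> is multiplied by its own sign. Hence \<open>|z|' \<le> A|z| + w\<close> almost everywhere.

  The off-diagonal entries of \<open>A\<close> are nonnegative, so \<open>exp(sA)\<close> is a nonnegative matrix for \<open>s \<ge> 0\<close>
  (\<open>matrix_exp_nonneg_metzler\<close>) and the differential inequality integrates to the claimed bound: the
  function \<open>exp((T-s)A) |z(s)| + P(T-s)\<close>, where \<open>P(r)\<close> is the integral of \<open>exp(\<sigma>A)w\<close> over
  \<open>0 \<le> \<sigma> \<le> r\<close>, has nonpositive derivative almost everywhere, and its values at \<open>0\<close> and \<open>T\<close> are the
  two sides of the inequality (\<open>metzler_comparison\<close>).

  Continuability comes from the same comparison. With the constant \<open>x_0 = \<xi>(0)\<close> in place of \<open>\<eta>\<close>, and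
  \<open>|f(x_0,u)| + w\<close> in place of \<open>w\<close>, it confines all solutions from \<open>x_0\<close> to one ball, on which the
  Picard iteration has a uniform existence time; finitely many steps reach \<open>\<tau>\<close>. Taking only the
  disturbance \<open>0\<close> in this argument shows that the general solution is defined up to \<open>\<tau>\<close>.

  Solutions are only absolutely continuous, so one analytic fact is used throughout: an absolutely
  continuous function whose derivative is almost everywhere nonpositive is nonincreasing
  (\<open>abs_continuous_nonincreasing\<close>). It also shows that solutions are Lipschitz on compact intervals,
  and Lipschitz functions are easy to glue and to multiply.
\<close>

section \<open>Absolute continuity and almost everywhere derivatives\<close>

lemma abs_continuous_on_dominated:
  fixes \<xi> :: "real \<Rightarrow> 'a::real_normed_vector" and q :: "real \<Rightarrow> 'b::real_normed_vector"
  assumes \<xi>: "abs_continuous_on S \<xi>" and "C \<ge> 0"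
    and dom: "\<And>u v. \<lbrakk>u \<in> S; v \<in> S; u \<le> v\<rbrakk> \<Longrightarrow> norm (q v - q u) \<le> C * (norm (\<xi> v - \<xi> u) + (v - u))"
  shows "abs_continuous_on S q"
  unfolding abs_continuous_on_def
proof (intro allI impI)
  fix \<epsilon> :: real assume "\<epsilon> > 0"
  define \<epsilon>' where "\<epsilon>' = \<epsilon> / (2 * (C + 1))"
  have "\<epsilon>' > 0" using \<open>\<epsilon> > 0\<close> \<open>C \<ge> 0\<close> by (simp add: \<epsilon>'_def)
  then obtain \<delta> where "\<delta> > 0" and \<delta>: "\<And>d T. \<lbrakk>d division_of T; T \<subseteq> S; (\<Sum>k\<in>d. Sup k - Inf k) < \<delta>\<rbrakk>
      \<Longrightarrow> (\<Sum>k\<in>d. norm (\<xi> (Sup k) - \<xi> (Inf k))) < \<epsilon>'"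
    using \<xi> unfolding abs_continuous_on_def by meson
  show "\<exists>\<delta>>0. \<forall>d T. d division_of T \<and> T \<subseteq> S \<and> (\<Sum>k\<in>d. Sup k - Inf k) < \<delta> \<longrightarrow>
        (\<Sum>k\<in>d. norm (q (Sup k) - q (Inf k))) < \<epsilon>"
  proof (intro exI[of _ "min \<delta> \<epsilon>'"] conjI allI impI)
    fix d T assume d: "d division_of T \<and> T \<subseteq> S \<and> (\<Sum>k\<in>d. Sup k - Inf k) < min \<delta> \<epsilon>'"
    have "(\<Sum>k\<in>d. norm (q (Sup k) - q (Inf k)))
        \<le> (\<Sum>k\<in>d. C * (norm (\<xi> (Sup k) - \<xi> (Inf k)) + (Sup k - Inf k)))"
    proof (rule sum_mono)
      fix k assume "k \<in> d"
      then obtain a b where k: "k = cbox a b" "k \<noteq> {}" "k \<subseteq> S"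
        using d by (metis division_ofD(2,3,4) order_trans)
      then have "a \<le> b" "Inf k = a" "Sup k = b" "a \<in> S" "b \<in> S" by auto
      then show "norm (q (Sup k) - q (Inf k)) \<le> C * (norm (\<xi> (Sup k) - \<xi> (Inf k)) + (Sup k - Inf k))"
        using dom by simp
    qed
    also have "\<dots> = C * ((\<Sum>k\<in>d. norm (\<xi> (Sup k) - \<xi> (Inf k))) + (\<Sum>k\<in>d. Sup k - Inf k))"
      by (simp only: sum.distrib sum_distrib_left[symmetric])
    also have "\<dots> \<le> C * (\<epsilon>' + \<epsilon>')"
      using \<delta>[of d T] d \<open>C \<ge> 0\<close> by (intro mult_left_mono add_mono) auto
    also have "\<dots> < (C + 1) * (\<epsilon>' + \<epsilon>')"
      using \<open>\<epsilon>' > 0\<close> by simp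
    also have "\<dots> = \<epsilon>"
    proof -
      have "\<epsilon>' * (2 * (C + 1)) = \<epsilon>" using \<open>C \<ge> 0\<close> by (simp add: \<epsilon>'_def)
      then show ?thesis by (simp add: algebra_simps)
    qed
    finally show "(\<Sum>k\<in>d. norm (q (Sup k) - q (Inf k))) < \<epsilon>" .
  qed (use \<open>\<delta> > 0\<close> \<open>\<epsilon>' > 0\<close> in auto)
qed

lemma lipschitz_imp_abs_continuous_on:
  fixes q :: "real \<Rightarrow> 'b::real_normed_vector"
  assumes "C-lipschitz_on S q"
  shows "abs_continuous_on S q"
proof (rule abs_continuous_on_dominated[where \<xi> = "\<lambda>_. 0::real"])
  show "abs_continuous_on S (\<lambda>_. 0::real)"
    unfolding abs_continuous_on_def by (auto intro!: exI[of _ 1])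
  show "C \<ge> 0" using assms by (rule lipschitz_on_nonneg)
  show "norm (q v - q u) \<le> C * (norm (0 - 0 :: real) + (v - u))" if "u \<in> S" "v \<in> S" "u \<le> v" for u v
    using lipschitz_on_normD[OF assms that(2,1)] that by simp
qed

text \<open>
  The exceptional set has measure zero, so it lies in an open set of small measure, on which absolute
  continuity makes the total variation of \<open>q\<close> small. Everywhere else the derivative controls the
  increments of \<open>q\<close> on short intervals. A gauge that combines the two yields a tagged division whose
  increments sum to at most an arbitrarily small number.
\<close>

lemma abs_continuous_nonincreasing:
  fixes q :: "real \<Rightarrow> real"
  assumes ac: "abs_continuous_on {a..b} q" and "a \<le> b" and N: "negligible N"
    and der: "\<And>s. s \<in> {a..b} - N \<Longrightarrow> \<exists>d\<le>0. (q has_vector_derivative d) (at s within {a..b})"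
  shows "q b \<le> q a"
proof (rule field_le_epsilon)
  fix e0 :: real assume "e0 > 0"
  define e where "e = e0 / (1 + (b - a))"
  have "e > 0" using \<open>e0 > 0\<close> \<open>a \<le> b\<close> by (simp add: e_def)
  obtain \<delta> where "\<delta> > 0" and \<delta>: "\<And>d T. \<lbrakk>d division_of T; T \<subseteq> {a..b}; (\<Sum>k\<in>d. Sup k - Inf k) < \<delta>\<rbrakk>
      \<Longrightarrow> (\<Sum>k\<in>d. norm (q (Sup k) - q (Inf k))) < e"
    using ac \<open>e > 0\<close> unfolding abs_continuous_on_def by meson
  obtain G where "open G" "N \<subseteq> G" "(G - N) \<in> lmeasurable" "emeasure lebesgue (G - N) < ennreal \<delta>"
    using sets_lebesgue_outer_open[of N \<delta>] N \<open>\<delta> > 0\<close> negligible_imp_sets by blast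
  have "G = (G - N) \<union> N" using \<open>N \<subseteq> G\<close> by auto
  then have Gm: "G \<in> lmeasurable"
    using \<open>(G - N) \<in> lmeasurable\<close> N by (metis fmeasurable.Un negligible_imp_measurable)
  have "measure lebesgue G = measure lebesgue (G - N)"
    by (rule measure_negligible_symdiff[symmetric])
       (use Gm in \<open>auto intro: negligible_subset[OF N]\<close>)
  also have "\<dots> < \<delta>"
    using \<open>emeasure lebesgue (G - N) < ennreal \<delta>\<close> \<open>(G - N) \<in> lmeasurable\<close> \<open>\<delta> > 0\<close>
    by (simp add: emeasure_eq_measure2 ennreal_less_iff)
  finally have G\<delta>: "measure lebesgue G < \<delta>" .
  have "\<exists>r>0. \<forall>y\<in>{a..b}. \<forall>x\<in>{a..b}. x \<le> s \<and> s \<le> y \<and> \<bar>y - s\<bar> < r \<and> \<bar>x - s\<bar> < r \<longrightarrow> q y - q x \<le> e * (y - x)"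
    if "s \<in> {a..b} - N" for s
  proof -
    from der[OF that] obtain d where "d \<le> 0"
      and d: "(q has_derivative (\<lambda>h. h *\<^sub>R d)) (at s within {a..b})"
      unfolding has_vector_derivative_def by blast
    then obtain r where "r > 0" and r: "\<And>y. \<lbrakk>y \<in> {a..b}; norm (y - s) < r\<rbrakk> \<Longrightarrow>
        norm (q y - q s - (y - s) *\<^sub>R d) \<le> e * norm (y - s)"
      using \<open>e > 0\<close> unfolding has_derivative_within_alt by blast
    show ?thesis
    proof (intro exI[of _ r] conjI ballI impI)
      fix x y assume "y \<in> {a..b}" "x \<in> {a..b}" and xy: "x \<le> s \<and> s \<le> y \<and> \<bar>y - s\<bar> < r \<and> \<bar>x - s\<bar> < r"
      then have "\<bar>q y - q s - (y - s) * d\<bar> \<le> e * (y - s)" "\<bar>q x - q s - (x - s) * d\<bar> \<le> e * (s - x)"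
        using r[of y] r[of x] by auto
      moreover have "(y - s) * d \<le> 0" "(x - s) * d \<ge> 0"
        using xy \<open>d \<le> 0\<close> by (auto intro: mult_nonneg_nonpos mult_nonpos_nonpos)
      ultimately show "q y - q x \<le> e * (y - x)"
        by (simp add: algebra_simps)
    qed (fact \<open>r > 0\<close>)
  qed
  then obtain r where rpos: "\<And>s. s \<in> {a..b} - N \<Longrightarrow> r s > 0"
    and r: "\<And>s x y. \<lbrakk>s \<in> {a..b} - N; y \<in> {a..b}; x \<in> {a..b}; x \<le> s; s \<le> y; \<bar>y - s\<bar> < r s; \<bar>x - s\<bar> < r s\<rbrakk>
       \<Longrightarrow> q y - q x \<le> e * (y - x)"
    by metis
  \<comment> \<open>Intervals tagged in \<open>N\<close> stay inside \<open>G\<close>; intervals tagged outside \<open>N\<close> are short.\<close>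
  define \<gamma> where "\<gamma> s = (if s \<in> N then G else if s \<in> {a..b} then ball s (r s) else UNIV)" for s
  have "gauge \<gamma>"
    using \<open>open G\<close> \<open>N \<subseteq> G\<close> rpos by (auto simp: gauge_def \<gamma>_def)
  then obtain p where p: "p tagged_division_of {a..b}" and fine: "\<gamma> fine p"
    using fine_division_exists_real by blast
  have fin: "finite p" using p by blast
  define p' where "p' = {(x,k)\<in>p. x \<in> N}"
  have p'p: "p' \<subseteq> p" by (auto simp: p'_def)
  have *: "\<exists>u v. k = {u..v} \<and> u \<le> x \<and> x \<le> v \<and> u \<in> {a..b} \<and> v \<in> {a..b} \<and> x \<in> {a..b} \<and> Inf k = u \<and> Sup k = v"
    if "(x,k) \<in> p" for x k
  proof -
    have "x \<in> k" "k \<subseteq> {a..b}" "\<exists>u v. k = cbox u v"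
      using tagged_division_ofD(2-4)[OF p that] by auto
    then obtain u v where "k = {u..v}" by auto
    then show ?thesis using \<open>x \<in> k\<close> \<open>k \<subseteq> {a..b}\<close> by auto
  qed
  have p'part: "p' tagged_division_of (\<Union>(snd ` p'))"
    using p p'p by (meson tagged_division_of_def tagged_partial_division_of_Union_self tagged_partial_division_subset)
  have div: "(snd ` p') division_of (\<Union>(snd ` p'))"
    using p'part by (rule division_of_tagged_division)
  have "(\<Sum>k\<in>snd ` p'. Sup k - Inf k) = (\<Sum>k\<in>snd ` p'. measure lebesgue k)"
  proof (rule sum.cong)
    fix k assume "k \<in> snd ` p'"
    then obtain x where "(x, k) \<in> p" using p'p by auto
    from *[OF this] obtain u v where "k = {u..v}" "u \<le> v" by auto
    then show "Sup k - Inf k = measure lebesgue k" by simp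
  qed simp
  also have "\<dots> = measure lebesgue (\<Union>(snd ` p'))"
    by (rule content_division[OF div])
  also have "\<dots> \<le> measure lebesgue G"
  proof (rule measure_mono_fmeasurable)
    show "\<Union>(snd ` p') \<subseteq> G"
      using fine by (fastforce simp: fine_def p'_def \<gamma>_def)
  qed (use Gm lmeasurable_division[OF div] in auto)
  finally have "(\<Sum>k\<in>snd ` p'. Sup k - Inf k) < \<delta>"
    using G\<delta> by simp
  moreover have "\<Union>(snd ` p') \<subseteq> {a..b}"
    using tagged_division_ofD(3)[OF p] p'p by fastforce
  ultimately have "(\<Sum>k\<in>snd ` p'. norm (q (Sup k) - q (Inf k))) < e"
    by (intro \<delta>[OF div])
  moreover have "(\<Sum>(x,k)\<in>p'. norm (q (Sup k) - q (Inf k))) = (\<Sum>k\<in>snd ` p'. norm (q (Sup k) - q (Inf k)))"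
  proof -
    \<comment> \<open>The value at the empty interval is set to \<open>0\<close>, as \<open>Sup\<close> and \<open>Inf\<close> of the empty set are unspecified.\<close>
    define h where "h k = (if k = {} then 0 else norm (q (Sup k) - q (Inf k)))" for k
    have "h (cbox u v) = 0" if "box u v = {}" for u v :: real
      using that by (auto simp: h_def)
    from sum.over_tagged_division_lemma[where d = h, OF p'part this]
    have h: "(\<Sum>(x,k)\<in>p'. h k) = (\<Sum>k\<in>snd ` p'. h k)" .
    have "h k = norm (q (Sup k) - q (Inf k))" if k: "k \<in> snd ` p'" for k
    proof -
      obtain x where "(x, k) \<in> p" using k p'p by auto
      from *[OF this] show ?thesis by (auto simp: h_def)
    qed
    moreover from this have "h k = norm (q (Sup k) - q (Inf k))" if "(x,k) \<in> p'" for x k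
      using that by (metis imageI snd_conv)
    ultimately have "(\<Sum>k\<in>snd ` p'. h k) = (\<Sum>k\<in>snd ` p'. norm (q (Sup k) - q (Inf k)))"
      "(\<Sum>(x,k)\<in>p'. h k) = (\<Sum>(x,k)\<in>p'. norm (q (Sup k) - q (Inf k)))"
      by (auto intro!: sum.cong)
    with h show ?thesis by simp
  qed
  ultimately have p'e: "(\<Sum>(x,k)\<in>p'. q (Sup k) - q (Inf k)) \<le> e"
    using sum_mono[of p' "\<lambda>(x,k). q (Sup k) - q (Inf k)" "\<lambda>(x,k). norm (q (Sup k) - q (Inf k))"] by force
  have "(\<Sum>(x,k)\<in>p-p'. q (Sup k) - q (Inf k)) \<le> (\<Sum>(x,k)\<in>p-p'. e * (Sup k - Inf k))"
  proof (rule sum_mono, clarify)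
    fix x k assume xk: "(x,k) \<in> p" "(x,k) \<notin> p'"
    then have "x \<notin> N" by (auto simp: p'_def)
    obtain u v where uv: "k = {u..v}" "u \<le> x" "x \<le> v" "u \<in> {a..b}" "v \<in> {a..b}" "x \<in> {a..b}"
      "Inf k = u" "Sup k = v" using *[OF xk(1)] by auto
    have "k \<subseteq> ball x (r x)"
      using fine xk \<open>x \<notin> N\<close> uv(6) by (auto simp: fine_def \<gamma>_def dest!: bspec)
    then have "u \<in> ball x (r x)" "v \<in> ball x (r x)" using uv(1-3) by (auto simp del: mem_ball)
    then show "q (Sup k) - q (Inf k) \<le> e * (Sup k - Inf k)"
      using r[of x v u] uv \<open>x \<notin> N\<close> by (auto simp: dist_real_def)
  qed
  also have "\<dots> \<le> (\<Sum>(x,k)\<in>p. e * (Sup k - Inf k))"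
    by (rule sum_mono2) (use fin * \<open>e > 0\<close> in \<open>fastforce+\<close>)
  also have "\<dots> = e * (b - a)"
    using additive_tagged_division_1[OF \<open>a \<le> b\<close> p, of "\<lambda>x. x"]
    by (simp add: sum_distrib_left[symmetric] case_prod_unfold)
  finally have "(\<Sum>(x,k)\<in>p. q (Sup k) - q (Inf k)) \<le> e + e * (b - a)"
    using p'e sum.subset_diff[OF p'p fin, of "\<lambda>(x,k). q (Sup k) - q (Inf k)"] by linarith
  also have "\<dots> = e * (1 + (b - a))" by (simp add: algebra_simps)
  also have "\<dots> = e0" using \<open>a \<le> b\<close> by (simp add: e_def)
  finally show "q b \<le> q a + e0"
    using additive_tagged_division_1[OF \<open>a \<le> b\<close> p, of q] by linarith
qed

text \<open>
  The increment from \<open>s\<close> to \<open>t\<close> is projected onto its own direction \<open>e\<close>; then \<open>\<xi> \<bullet> e - M t\<close> is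
  nonincreasing.
\<close>

lemma abs_continuous_bounded_derivative_imp_lipschitz:
  fixes \<xi> :: "real \<Rightarrow> 'a::real_inner"
  assumes ac: "abs_continuous_on {a..b} \<xi>" and N: "negligible N" and "M \<ge> 0"
    and der: "\<And>s. s \<in> {a..b} - N \<Longrightarrow> \<exists>d. norm d \<le> M \<and> (\<xi> has_vector_derivative d) (at s within {a..b})"
  shows "M-lipschitz_on {a..b} \<xi>"
proof (rule lipschitz_on_leI)
  fix s t assume st: "s \<in> {a..b}" "t \<in> {a..b}" "s \<le> t"
  define e where "e = sgn (\<xi> t - \<xi> s)"
  have e: "norm e \<le> 1" by (simp add: e_def norm_sgn)
  have sub: "{s..t} \<subseteq> {a..b}" using st by auto
  have "\<xi> t \<bullet> e - M * t \<le> \<xi> s \<bullet> e - M * s"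
  proof (rule abs_continuous_nonincreasing[where N = N and q = "\<lambda>r. \<xi> r \<bullet> e - M * r" and a = s and b = t])
    show "abs_continuous_on {s..t} (\<lambda>r. \<xi> r \<bullet> e - M * r)"
    proof (rule abs_continuous_on_dominated[where C = "1 + M"])
      show "abs_continuous_on {s..t} \<xi>"
        using ac sub unfolding abs_continuous_on_def by (meson order_trans)
      fix u v :: real assume uv: "u \<le> v"
      have "norm (\<xi> v \<bullet> e - M * v - (\<xi> u \<bullet> e - M * u)) \<le> \<bar>(\<xi> v - \<xi> u) \<bullet> e\<bar> + M * (v - u)"
        using abs_triangle_ineq4[of "(\<xi> v - \<xi> u) \<bullet> e" "M * (v - u)"] uv \<open>M \<ge> 0\<close>
        by (simp add: inner_diff_left algebra_simps abs_mult mult_left_mono)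
      also have "\<bar>(\<xi> v - \<xi> u) \<bullet> e\<bar> \<le> norm (\<xi> v - \<xi> u) * 1"
        using e by (meson Cauchy_Schwarz_ineq2 mult_left_mono norm_ge_zero order_trans)
      finally show "norm (\<xi> v \<bullet> e - M * v - (\<xi> u \<bullet> e - M * u)) \<le> (1 + M) * (norm (\<xi> v - \<xi> u) + (v - u))"
        using uv mult_nonneg_nonneg[OF \<open>M \<ge> 0\<close> norm_ge_zero[of "\<xi> v - \<xi> u"]]
        unfolding distrib_left distrib_right by simp
    qed (use \<open>M \<ge> 0\<close> in auto)
    fix r assume r: "r \<in> {s..t} - N"
    then obtain d where d: "norm d \<le> M" "(\<xi> has_vector_derivative d) (at r within {a..b})"
      using der sub by blast
    have "((\<lambda>r. \<xi> r \<bullet> e - M * r) has_vector_derivative (d \<bullet> e - M)) (at r within {s..t})"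
      using has_vector_derivative_within_subset[OF d(2) sub]
      by (auto simp: has_vector_derivative_def inner_diff_left algebra_simps intro!: derivative_eq_intros)
    moreover have "d \<bullet> e \<le> norm d * 1"
      using e by (meson norm_cauchy_schwarz mult_left_mono norm_ge_zero order_trans)
    ultimately show "\<exists>d\<le>0. ((\<lambda>r. \<xi> r \<bullet> e - M * r) has_vector_derivative d) (at r within {s..t})"
      using d(1) by (intro exI[of _ "d \<bullet> e - M"]) auto
  qed (use st N in auto)
  then have "(\<xi> t - \<xi> s) \<bullet> e \<le> M * (t - s)"
    by (simp add: inner_diff_left algebra_simps)
  moreover have "(\<xi> t - \<xi> s) \<bullet> e = norm (\<xi> t - \<xi> s)"
    by (cases "\<xi> t - \<xi> s = 0") (auto simp: e_def sgn_div_norm dot_square_norm power2_eq_square)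
  ultimately show "dist (\<xi> s) (\<xi> t) \<le> M * dist s t"
    using st by (simp add: dist_norm norm_minus_commute)
qed (fact \<open>M \<ge> 0\<close>)

section \<open>The matrix exponential\<close>

abbreviation matrix_pow :: "real^'n^'n \<Rightarrow> nat \<Rightarrow> real^'n^'n" where
  "matrix_pow A k \<equiv> ((**) A ^^ k) (mat 1)"

definition metzler :: "real^'n^'n \<Rightarrow> bool" where
  "metzler A \<longleftrightarrow> (\<forall>i j. i \<noteq> j \<longrightarrow> A $ i $ j \<ge> 0)"

lemma matrix_pow_Suc_right: "matrix_pow A (Suc k) = matrix_pow A k ** A"
  by (induction k) (simp_all add: matrix_mul_assoc)

lemma matrix_pow_scaleR: "matrix_pow (t *\<^sub>R A) k = t ^ k *\<^sub>R matrix_pow A k"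
  by (induction k) (simp_all add: scalar_matrix_assoc[symmetric] matrix_scalar_ac)

lemma matrix_pow_entry_bound:
  fixes A :: "real^'n^'n"
  assumes A: "\<And>i j. \<bar>A $ i $ j\<bar> \<le> c" 
  shows "\<bar>matrix_pow A k $ i $ j\<bar> \<le> (real CARD('n) * c) ^ k"
proof (induction k arbitrary: i j)
  case 0
  then show ?case by (simp add: mat_def)
next
  case (Suc k)
  have "c \<ge> 0" using A[of i j] by linarith
  have "\<bar>matrix_pow A (Suc k) $ i $ j\<bar> = \<bar>\<Sum>l\<in>UNIV. A $ i $ l * matrix_pow A k $ l $ j\<bar>"
    by (simp add: matrix_matrix_mult_def)
  also have "\<dots> \<le> (\<Sum>l\<in>(UNIV::'n set). \<bar>A $ i $ l * matrix_pow A k $ l $ j\<bar>)"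
    by (rule sum_abs)
  also have "\<dots> \<le> (\<Sum>l\<in>(UNIV::'n set). c * (real CARD('n) * c) ^ k)"
    unfolding abs_mult by (intro sum_mono mult_mono A Suc.IH \<open>c \<ge> 0\<close>) simp
  also have "\<dots> = (real CARD('n) * c) ^ Suc k"
    by simp
  finally show ?case .
qed

lemma sums_vecI:
  fixes f :: "nat \<Rightarrow> 'a::real_normed_vector^'n"
  assumes "\<And>i. (\<lambda>k. f k $ i) sums (x $ i)"
  shows "f sums x"
  using assms unfolding sums_def by (intro vec_tendstoI) (simp add: sum_component)

text \<open>
  Each entry of \<open>exp(tA)\<close> is a scalar power series in \<open>t\<close>, so derivatives can be taken termwise and
  entrywise.
\<close>

lemma matrix_exp_entry_sums:
  fixes A :: "real^'n^'n"
  shows "(\<lambda>k. matrix_pow A k $ i $ j / fact k * t ^ k) sums (matrix_exp (t *\<^sub>R A) $ i $ j)"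
proof -
  define a where "a i j k = matrix_pow A k $ i $ j / fact k * t ^ k" for i j k
  obtain c where c: "\<And>i j. \<bar>A $ i $ j\<bar> \<le> c"
  proof
    show "\<bar>A $ i $ j\<bar> \<le> norm A" for i j
      by (rule order_trans[OF component_le_norm_cart Finite_Cartesian_Product.norm_nth_le])
  qed
  have "summable (a i j)" for i j
  proof (rule summable_comparison_test')
    show "summable (\<lambda>k. inverse (fact k) * (real CARD('n) * c * \<bar>t\<bar>) ^ k)"
      by (rule summable_exp)
    show "norm (a i j k) \<le> inverse (fact k) * (real CARD('n) * c * \<bar>t\<bar>) ^ k" for k
      using mult_right_mono[OF matrix_pow_entry_bound[where A = A and c = c and k = k and i = i and j = j, OF c], of "\<bar>t\<bar> ^ k / fact k"]
      by (simp add: a_def abs_mult power_mult_distrib power_abs field_simps)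
  qed
  then have s: "a i j sums suminf (a i j)" for i j
    by (rule summable_sums)
  have "(\<lambda>k. (1 / fact k) *\<^sub>R matrix_pow (t *\<^sub>R A) k) sums (\<chi> i j. suminf (a i j))"
    by (intro sums_vecI) (use s in \<open>simp add: a_def[abs_def] matrix_pow_scaleR mult_ac\<close>)
  then have "matrix_exp (t *\<^sub>R A) = (\<chi> i j. suminf (a i j))"
    unfolding matrix_exp_def by (rule sums_unique[symmetric])
  with s[of i j] show ?thesis
    unfolding a_def[abs_def] by simp
qed

lemma matrix_exp_zero: "matrix_exp (0::real^'n^'n) = mat 1"
proof -
  have "matrix_exp (0 *\<^sub>R (mat 1 :: real^'n^'n)) $ i $ j = (mat 1 :: real^'n^'n) $ i $ j" for i j
    using sums_unique2[OF matrix_exp_entry_sums[where A = "mat 1" and t = 0] powser_sums_zero] by simp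
  then show ?thesis by (simp add: vec_eq_iff)
qed

text \<open>
  The termwise differentiated series sums to both products, because matrix powers can be peeled off on
  either side. This gives the derivative and the commutation of \<open>A\<close> with \<open>exp(tA)\<close> at once.
\<close>

lemma matrix_exp_derivative_sums:
  "(\<lambda>k. matrix_pow A (Suc k) $ i $ j / fact k * t ^ k) sums ((A ** matrix_exp (t *\<^sub>R A)) $ i $ j)"
  "(\<lambda>k. matrix_pow A (Suc k) $ i $ j / fact k * t ^ k) sums ((matrix_exp (t *\<^sub>R A) ** A) $ i $ j)"
proof -
  have "(\<lambda>k. \<Sum>l\<in>UNIV. A $ i $ l * (matrix_pow A k $ l $ j / fact k * t ^ k)) sums
      (\<Sum>l\<in>UNIV. A $ i $ l * matrix_exp (t *\<^sub>R A) $ l $ j)"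
    by (intro sums_sum sums_mult matrix_exp_entry_sums)
  then show "(\<lambda>k. matrix_pow A (Suc k) $ i $ j / fact k * t ^ k) sums ((A ** matrix_exp (t *\<^sub>R A)) $ i $ j)"
    by (simp add: matrix_matrix_mult_def sum_distrib_left sum_distrib_right sum_divide_distrib mult_ac)
  have "(\<lambda>k. \<Sum>l\<in>UNIV. (matrix_pow A k $ i $ l / fact k * t ^ k) * A $ l $ j) sums
      (\<Sum>l\<in>UNIV. matrix_exp (t *\<^sub>R A) $ i $ l * A $ l $ j)"
    by (intro sums_sum sums_mult2 matrix_exp_entry_sums)
  then show "(\<lambda>k. matrix_pow A (Suc k) $ i $ j / fact k * t ^ k) sums ((matrix_exp (t *\<^sub>R A) ** A) $ i $ j)"
    unfolding matrix_pow_Suc_right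
    by (simp add: matrix_matrix_mult_def sum_distrib_left sum_distrib_right sum_divide_distrib mult_ac)
qed

lemma matrix_exp_commute: "A ** matrix_exp (t *\<^sub>R A) = matrix_exp (t *\<^sub>R A) ** A"
  unfolding vec_eq_iff using sums_unique2[OF matrix_exp_derivative_sums] by blast

lemma has_vector_derivative_vecI:
  fixes f :: "real \<Rightarrow> ('a::real_normed_vector)^'n"
  assumes "\<And>i. ((\<lambda>t. f t $ i) has_vector_derivative d $ i) (at t within S)"
  shows "(f has_vector_derivative d) (at t within S)"
  unfolding has_vector_derivative_def has_derivative_within
proof (intro conjI vec_tendstoI)
  show "((\<lambda>s. ((1 / norm (s - t)) *\<^sub>R (f s - (f t + (s - t) *\<^sub>R d))) $ i) \<longlongrightarrow> 0 $ i) (at t within S)" for i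
    using assms[of i] by (simp add: has_vector_derivative_def has_derivative_within)
qed (rule bounded_linear_scaleR_left)

lemma matrix_exp_has_vector_derivative:
  "((\<lambda>t. matrix_exp (t *\<^sub>R A)) has_vector_derivative A ** matrix_exp (t *\<^sub>R A)) (at t within S)"
proof (rule has_vector_derivative_at_within, rule has_vector_derivative_vecI, rule has_vector_derivative_vecI)
  fix i j
  define c where "c k = matrix_pow A k $ i $ j / fact k" for k
  have c: "(\<lambda>k. c k * t ^ k) sums (matrix_exp (t *\<^sub>R A) $ i $ j)" for t
    using matrix_exp_entry_sums by (simp add: c_def)
  have "((\<lambda>t. \<Sum>k. c k * t ^ k) has_field_derivative (\<Sum>k. diffs c k * t ^ k)) (at t)"
    by (rule termdiffs_strong_converges_everywhere) (rule sums_summable[OF c])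
  moreover have "(\<Sum>k. c k * t ^ k) = matrix_exp (t *\<^sub>R A) $ i $ j" for t
    using sums_unique[OF c] by simp
  moreover have "diffs c k = matrix_pow A (Suc k) $ i $ j / fact k" for k
    by (simp add: diffs_def c_def del: funpow.simps)
  then have "(\<lambda>k. diffs c k * t ^ k) sums ((A ** matrix_exp (t *\<^sub>R A)) $ i $ j)"
    using matrix_exp_derivative_sums(1) by (simp del: funpow.simps)
  then have "(\<Sum>k. diffs c k * t ^ k) = (A ** matrix_exp (t *\<^sub>R A)) $ i $ j"
    by (rule sums_unique[symmetric])
  ultimately show "((\<lambda>t. matrix_exp (t *\<^sub>R A) $ i $ j) has_vector_derivative
      (A ** matrix_exp (t *\<^sub>R A)) $ i $ j) (at t)"
    by (simp add: has_real_derivative_iff_has_vector_derivative)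
qed

lemma continuous_on_matrix_exp: "continuous_on S (\<lambda>t. matrix_exp (t *\<^sub>R A))"
  using matrix_exp_has_vector_derivative by (rule continuous_on_vector_derivative)

lemma matrix_exp_nonneg:
  assumes A: "\<And>i j. A $ i $ j \<ge> 0" and "t \<ge> 0"
  shows "matrix_exp (t *\<^sub>R A) $ i $ j \<ge> 0"
proof -
  have "matrix_pow A k $ i $ j \<ge> 0" for k i j
    by (induction k arbitrary: i j)
       (auto simp: mat_def matrix_matrix_mult_def A intro!: sum_nonneg mult_nonneg_nonneg)
  then show ?thesis
    using \<open>t \<ge> 0\<close> by (intro sums_le[OF _ sums_zero matrix_exp_entry_sums]) simp
qed

lemma matrix_mult_add_rdistrib: "((B :: real^'n^'m) + C) ** A = B ** A + C ** A"
  by (simp add: matrix_matrix_mult_def vec_eq_iff sum.distrib distrib_right)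

lemma bounded_bilinear_matrix_matrix_mult:
  "bounded_bilinear ((**) :: real^'n^'m \<Rightarrow> real^'p^'n \<Rightarrow> real^'p^'m)"
  unfolding bilinear_conv_bounded_bilinear[symmetric] bilinear_def
  by (auto simp: linear_iff matrix_add_ldistrib matrix_mult_add_rdistrib scalar_matrix_assoc[symmetric] matrix_scalar_ac)

lemma bounded_bilinear_matrix_vector_mult:
  "bounded_bilinear ((*v) :: real^'n^'m \<Rightarrow> real^'n \<Rightarrow> real^'m)"
  unfolding bilinear_conv_bounded_bilinear[symmetric] bilinear_def
  by (auto simp: linear_iff matrix_vector_mult_add_rdistrib matrix_vector_right_distrib
     scaleR_matrix_vector_assoc[symmetric] matrix_vector_mult_scaleR)

lemma matrix_exp_reflect_has_vector_derivative:
  "((\<lambda>s. matrix_exp ((t - s) *\<^sub>R A)) has_vector_derivative - (A ** matrix_exp ((t - s) *\<^sub>R A))) (at s within S)"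
proof -
  have "((\<lambda>s. t - s) has_vector_derivative - 1) (at s)"
    by (auto intro!: derivative_eq_intros simp: has_vector_derivative_def)
  from vector_diff_chain_at[OF this matrix_exp_has_vector_derivative[where S = UNIV]]
  have "((\<lambda>s. matrix_exp ((t - s) *\<^sub>R A)) has_vector_derivative - (A ** matrix_exp ((t - s) *\<^sub>R A))) (at s)"
    by (simp add: o_def)
  then show ?thesis by (rule has_vector_derivative_at_within)
qed

text \<open>
  Shifting the diagonal by \<open>\<mu>\<close> makes \<open>A\<close> a nonnegative matrix \<open>M\<close>, whose exponential is nonnegative by
  its series. The identity \<open>exp(tA) = exp(-\<mu>t) exp(tM)\<close> holds because
  \<open>exp(-\<mu>s) exp(sM) exp((t-s)A)\<close> does not depend on \<open>s\<close>; compare \<open>s = 0\<close> and \<open>s = t\<close>.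
\<close>

lemma matrix_exp_nonneg_metzler:
  assumes A: "metzler A" and "t \<ge> 0"
  shows "matrix_exp (t *\<^sub>R A) $ i $ j \<ge> 0"
proof -
  define \<mu> where "\<mu> = (\<Sum>i\<in>UNIV. \<bar>A $ i $ i\<bar>)"
  define M where "M = A + \<mu> *\<^sub>R mat 1"
  have diag: "\<bar>A $ i $ i\<bar> \<le> \<mu>" for i
    unfolding \<mu>_def by (rule member_le_sum) auto
  have M: "M $ i $ j \<ge> 0" for i j
    using A diag[of i] by (auto simp: M_def mat_def metzler_def)
  define F where "F s = exp (- \<mu> * s) *\<^sub>R (matrix_exp (s *\<^sub>R M) ** matrix_exp ((t - s) *\<^sub>R A))" for s
  have "(F has_vector_derivative 0) (at s within UNIV)" for s
  proof -
    let ?E = "matrix_exp (s *\<^sub>R M)" and ?B = "matrix_exp ((t - s) *\<^sub>R A)"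
    have 1: "((\<lambda>s. matrix_exp (s *\<^sub>R M) ** matrix_exp ((t - s) *\<^sub>R A)) has_vector_derivative
       ?E ** - (A ** ?B) + (M ** ?E) ** ?B) (at s within UNIV)"
      by (rule bounded_bilinear.has_vector_derivative[OF bounded_bilinear_matrix_matrix_mult
          matrix_exp_has_vector_derivative matrix_exp_reflect_has_vector_derivative])
    have "(M ** ?E) ** ?B = ?E ** (A ** ?B) + \<mu> *\<^sub>R (?E ** ?B)"
    proof -
      have "?E ** M = ?E ** A + \<mu> *\<^sub>R ?E"
        by (subst (2) M_def) (simp add: matrix_add_ldistrib scalar_matrix_assoc[symmetric] matrix_scalar_ac)
      then show ?thesis
        by (simp add: matrix_exp_commute[of M] matrix_mult_add_rdistrib scalar_matrix_assoc[symmetric] matrix_mul_assoc)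
    qed
    moreover have "?E ** - (A ** ?B) = - (?E ** (A ** ?B))"
      by (simp add: bounded_bilinear.minus_right[OF bounded_bilinear_matrix_matrix_mult])
    ultimately have 2: "((\<lambda>s. matrix_exp (s *\<^sub>R M) ** matrix_exp ((t - s) *\<^sub>R A)) has_vector_derivative
       \<mu> *\<^sub>R (?E ** ?B)) (at s within UNIV)"
      using 1 by simp
    have 3: "((\<lambda>s. exp (- \<mu> * s)) has_vector_derivative (- \<mu> * exp (- \<mu> * s))) (at s within UNIV)"
      unfolding has_real_derivative_iff_has_vector_derivative[symmetric]
      by (auto intro!: derivative_eq_intros)
    show ?thesis
      using bounded_bilinear.has_vector_derivative[OF bounded_bilinear_scaleR 3 2]
      by (simp add: F_def[abs_def] algebra_simps)
  qed
  then have "F t = F 0"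
    using has_vector_derivative_zero_constant[of UNIV F] by (metis convex_UNIV UNIV_I)
  then have "matrix_exp (t *\<^sub>R A) = exp (- \<mu> * t) *\<^sub>R matrix_exp (t *\<^sub>R M)"
    by (simp add: F_def matrix_exp_zero)
  then show ?thesis
    using matrix_exp_nonneg[OF M \<open>t \<ge> 0\<close>] by simp
qed

section \<open>Comparison for cooperative linear differential inequalities\<close>

text \<open>
  Zeros with nonzero derivative are isolated. As a consequence, \<open>|z|\<close> is differentiable at all but
  countably many of the points at which \<open>z\<close> is differentiable.
\<close>

lemma countable_simple_zeros:
  fixes z :: "real \<Rightarrow> real"
  shows "countable {s\<in>S. z s = 0 \<and> (\<exists>d. d \<noteq> 0 \<and> (z has_vector_derivative d) (at s within S))}"
proof -
  define X where "X = {s\<in>S. z s = 0 \<and> (\<exists>d. d \<noteq> 0 \<and> (z has_vector_derivative d) (at s within S))}"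
  have "\<exists>r>0. X \<inter> ball s r = {s}" if "s \<in> X" for s
  proof -
    obtain d where "s \<in> S" "z s = 0" "d \<noteq> 0" and d: "(z has_derivative (\<lambda>h. h *\<^sub>R d)) (at s within S)"
      using \<open>s \<in> X\<close> by (auto simp: X_def has_vector_derivative_def)
    have "\<bar>d\<bar> / 2 > 0" using \<open>d \<noteq> 0\<close> by simp
    with d obtain r where "r > 0" and r: "\<And>y. \<lbrakk>y \<in> S; norm (y - s) < r\<rbrakk> \<Longrightarrow>
        norm (z y - z s - (y - s) *\<^sub>R d) \<le> \<bar>d\<bar> / 2 * norm (y - s)"
      unfolding has_derivative_within_alt by blast
    have "y = s" if "y \<in> X \<inter> ball s r" for y
    proof -
      have "norm (z y - z s - (y - s) *\<^sub>R d) \<le> \<bar>d\<bar> / 2 * norm (y - s)"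
        using that by (intro r) (auto simp: X_def dist_norm norm_minus_commute)
      then have "\<bar>y - s\<bar> * \<bar>d\<bar> \<le> \<bar>d\<bar> / 2 * \<bar>y - s\<bar>"
        using that \<open>z s = 0\<close> by (simp add: X_def abs_mult)
      then have "\<bar>y - s\<bar> * \<bar>d\<bar> \<le> 0" by (simp add: mult.commute)
      then show "y = s" using \<open>d \<noteq> 0\<close> by (simp add: mult_le_0_iff)
    qed
    then have "X \<inter> ball s r \<subseteq> {s}" by (intro subsetI) (simp only: singleton_iff)
    moreover have "{s} \<subseteq> X \<inter> ball s r" using \<open>s \<in> X\<close> \<open>r > 0\<close> by simp
    ultimately have "X \<inter> ball s r = {s}" by (rule antisym)
    with \<open>r > 0\<close> show ?thesis by (intro exI[of _ r] conjI)
  qed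
  then obtain r where r: "\<And>s. s \<in> X \<Longrightarrow> r s > 0 \<and> X \<inter> ball s (r s) = {s}"
    by metis
  define D where "D = (\<Union>s\<in>X. ball s (r s))"
  have "X sparse_in D"
    unfolding sparse_in_def
  proof
    fix y assume "y \<in> D"
    then obtain s where s: "s \<in> X" "y \<in> ball s (r s)" by (auto simp: D_def)
    have "\<not> x islimpt X" if "x \<in> ball s (r s)" for x
    proof
      assume "x islimpt X"
      then have "infinite (X \<inter> ball s (r s))"
        using that unfolding islimpt_eq_acc_point by (metis Int_commute open_ball)
      then show False using r[OF s(1)] by simp
    qed
    then show "\<exists>B. y \<in> B \<and> open B \<and> (\<forall>y\<in>B. \<not> y islimpt X)"
      using s by (meson open_ball)
  qed
  then have "countable (D \<inter> X)"
    by (rule sparse_imp_countable[rotated]) (auto simp: D_def)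
  moreover have "X \<subseteq> D"
    using r by (force simp: D_def)
  ultimately show ?thesis
    by (simp add: Int_absorb1 X_def)
qed

text \<open>
  At a zero of \<open>z\<close> the convention \<open>sgn 0 = 0\<close> gives the correct derivative \<open>0\<close>.
\<close>

lemma has_vector_derivative_abs:
  fixes z :: "real \<Rightarrow> real"
  assumes z: "(z has_vector_derivative d) (at s within S)" and "s \<in> S" and "z s = 0 \<Longrightarrow> d = 0"
  shows "((\<lambda>s. \<bar>z s\<bar>) has_vector_derivative sgn (z s) * d) (at s within S)"
proof (cases "z s = 0")
  case True
  then have "d = 0" using assms(3) by simp
  have "((\<lambda>y. (1 / norm (y - s)) *\<^sub>R z y) \<longlongrightarrow> 0) (at s within S)"
    using z True \<open>d = 0\<close> by (simp add: has_vector_derivative_def has_derivative_within)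
  then have "((\<lambda>y. \<bar>(1 / norm (y - s)) *\<^sub>R z y\<bar>) \<longlongrightarrow> 0) (at s within S)"
    using tendsto_rabs_zero by blast
  then show ?thesis
    using True by (simp add: has_vector_derivative_def has_derivative_within abs_mult)
next
  case False
  have "continuous (at s within S) z"
    using z by (rule has_vector_derivative_continuous)
  then obtain r where "r > 0" and r: "\<And>y. \<lbrakk>y \<in> S; dist y s < r\<rbrakk> \<Longrightarrow> dist (z y) (z s) < \<bar>z s\<bar>"
    using False unfolding continuous_within_eps_delta by (metis zero_less_abs_iff)
  have "((\<lambda>y. sgn (z s) * z y) has_vector_derivative sgn (z s) * d) (at s within S)"
    by (rule bounded_linear.has_vector_derivative[OF bounded_linear_mult_right z])
  then show ?thesis
  proof (rule has_vector_derivative_transform_within[OF _ \<open>r > 0\<close> \<open>s \<in> S\<close>])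
    fix y assume "y \<in> S" "dist y s < r"
    from r[OF this] show "sgn (z s) * z y = \<bar>z y\<bar>"
      by (auto simp: dist_real_def sgn_if)
  qed
qed

lemma negligible_countable: "countable (X :: 'a::euclidean_space set) \<Longrightarrow> negligible X"
  by (simp add: countable_imp_null_set_lborel negligible_iff_null_sets null_sets_completionI)

lemma C1_imp_lipschitz:
  fixes f :: "real \<Rightarrow> 'a::real_normed_vector"
  assumes f: "\<And>s. s \<in> {a..b} \<Longrightarrow> (f has_vector_derivative f' s) (at s within {a..b})"
    and "continuous_on {a..b} f'"
  shows "\<exists>L. L-lipschitz_on {a..b} f"
proof -
  obtain B where B: "B > 0" "\<And>s. s \<in> {a..b} \<Longrightarrow> norm (f' s) \<le> B"
    using compact_imp_bounded[OF compact_continuous_image[OF assms(2) compact_Icc]]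
    by (auto simp: bounded_pos)
  have "B-lipschitz_on {a..b} f"
  proof (rule bounded_derivative_imp_lipschitz)
    show "(f has_derivative (\<lambda>h. h *\<^sub>R f' s)) (at s within {a..b})" if "s \<in> {a..b}" for s
      using f[OF that] by (simp add: has_vector_derivative_def)
    show "onorm (\<lambda>h. h *\<^sub>R f' s) \<le> B" if "s \<in> {a..b}" for s
      using B(2)[OF that] by (intro onorm_le) (metis mult.commute mult_left_mono norm_ge_zero norm_scaleR real_norm_def)
  qed (use \<open>B > 0\<close> in auto)
  then show ?thesis ..
qed

lemma lipschitz_on_bilinear:
  fixes f :: "real \<Rightarrow> 'a::real_normed_vector" and g :: "real \<Rightarrow> 'b::real_normed_vector"
    and h :: "'a \<Rightarrow> 'b \<Rightarrow> 'c::real_normed_vector"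
  assumes h: "bounded_bilinear h" and f: "C-lipschitz_on {a..b} f" and g: "D-lipschitz_on {a..b} g"
  shows "\<exists>L. L-lipschitz_on {a..b} (\<lambda>s. h (f s) (g s))"
proof -
  obtain K where K: "K \<ge> 0" "\<And>x y. norm (h x y) \<le> norm x * norm y * K"
    using bounded_bilinear.nonneg_bounded[OF h] by blast
  obtain F where F: "F > 0" "\<And>s. s \<in> {a..b} \<Longrightarrow> norm (f s) \<le> F"
    using compact_imp_bounded[OF compact_continuous_image[OF lipschitz_on_continuous_on[OF f] compact_Icc]]
    by (auto simp: bounded_pos)
  obtain G where G: "G > 0" "\<And>s. s \<in> {a..b} \<Longrightarrow> norm (g s) \<le> G"
    using compact_imp_bounded[OF compact_continuous_image[OF lipschitz_on_continuous_on[OF g] compact_Icc]]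
    by (auto simp: bounded_pos)
  note C = lipschitz_on_nonneg[OF f] and D = lipschitz_on_nonneg[OF g]
  have "(F * D * K + C * G * K)-lipschitz_on {a..b} (\<lambda>s. h (f s) (g s))"
  proof (rule lipschitz_onI)
    fix s t assume st: "s \<in> {a..b}" "t \<in> {a..b}"
    have "h (f s) (g s) - h (f t) (g t) = h (f s) (g s - g t) + h (f s - f t) (g t)"
      by (simp add: bounded_bilinear.diff_left[OF h] bounded_bilinear.diff_right[OF h])
    then have "norm (h (f s) (g s) - h (f t) (g t)) \<le> norm (f s) * norm (g s - g t) * K + norm (f s - f t) * norm (g t) * K"
      using norm_triangle_mono[OF K(2) K(2)] by metis
    also have "\<dots> \<le> F * (D * norm (s - t)) * K + (C * norm (s - t)) * G * K"
      using st C D F G K(1) lipschitz_on_normD[OF f] lipschitz_on_normD[OF g]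
      by (intro add_mono mult_right_mono mult_mono) (auto simp: less_imp_le)
    finally show "dist (h (f s) (g s)) (h (f t) (g t)) \<le> (F * D * K + C * G * K) * dist s t"
      by (simp add: dist_norm algebra_simps)
  qed (use C D F G K(1) in auto)
  then show ?thesis ..
qed

lemma abs_vec_nth [simp]: "\<bar>x :: real^'n\<bar> $ i = \<bar>x $ i\<bar>"
  by (simp add: abs_vec_def)

lemma lipschitz_on_abs_vec:
  fixes z :: "'a::metric_space \<Rightarrow> real^'n"
  assumes "C-lipschitz_on S z"
  shows "C-lipschitz_on S (\<lambda>s. \<bar>z s\<bar>)"
proof (rule lipschitz_onI)
  fix s t assume "s \<in> S" "t \<in> S"
  have "norm (\<bar>z s\<bar> - \<bar>z t\<bar>) \<le> norm (z s - z t)"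
    by (rule norm_le_componentwise_cart) (simp add: abs_triangle_ineq3)
  then show "dist \<bar>z s\<bar> \<bar>z t\<bar> \<le> C * dist s t"
    using lipschitz_onD[OF assms \<open>s \<in> S\<close> \<open>t \<in> S\<close>] by (simp add: dist_norm)
qed (rule lipschitz_on_nonneg[OF assms])

lemma matrix_vector_mult_nonneg:
  fixes E :: "real^'n^'m" and x :: "real^'n"
  assumes "\<And>i j. E $ i $ j \<ge> 0" and "x \<ge> 0"
  shows "E *v x \<ge> 0"
  using assms by (auto simp: less_eq_vec_def matrix_vector_mult_def intro!: sum_nonneg mult_nonneg_nonneg)

text \<open>
  The auxiliary function \<open>q(s) = exp((T-s)A) |z(s)| + P(T-s)\<close> has the derivative
  \<open>- exp((T-s)A) (A|z| + c - |z|')\<close> almost everywhere. It is nonpositive as the exponential is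
  nonnegative, so \<open>q(T) \<le> q(0)\<close>. Putting the kernel into \<open>q\<close> avoids any use of \<open>exp(-sA)\<close>, which need not
  be nonnegative.
\<close>

lemma metzler_comparison:
  fixes z :: "real \<Rightarrow> real^'n"
  assumes A: "metzler A" and "T \<ge> 0" and z: "C-lipschitz_on {0..T} z" and N: "negligible N"
    and der: "\<And>s. s \<in> {0..T} - N \<Longrightarrow> \<exists>d. (z has_vector_derivative d) (at s within {0..T}) \<and>
       (\<forall>i. sgn (z s $ i) * d $ i \<le> (A *v \<bar>z s\<bar> + c) $ i)"
  shows "\<bar>z T\<bar> \<le> matrix_exp (T *\<^sub>R A) *v \<bar>z 0\<bar> + integral {0..T} (\<lambda>s. matrix_exp (s *\<^sub>R A) *v c)"
proof -
  define E where "E s = matrix_exp (s *\<^sub>R A)" for s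
  define P where "P r = integral {0..r} (\<lambda>s. E s *v c)" for r
  define q where "q s = E (T - s) *v \<bar>z s\<bar> + P (T - s)" for s
  have dE: "((\<lambda>s. E (T - s)) has_vector_derivative - (A ** E (T - s))) (at s within S)" for s S
    unfolding E_def by (rule matrix_exp_reflect_has_vector_derivative)
  have contE: "continuous_on S E" for S
    unfolding E_def by (rule continuous_on_matrix_exp)
  have contE': "continuous_on S (\<lambda>s. E (T - s))" for S
    by (rule continuous_on_compose2[OF contE[of UNIV]]) (auto intro: continuous_intros)
  have contEc: "continuous_on S (\<lambda>s. E s *v c)" for S
    by (rule bounded_bilinear.continuous_on[OF bounded_bilinear_matrix_vector_mult contE continuous_on_const])
  have contEc': "continuous_on S (\<lambda>s. - (E (T - s) *v c))" for S
    by (intro continuous_on_minus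
        bounded_bilinear.continuous_on[OF bounded_bilinear_matrix_vector_mult contE' continuous_on_const])
  have dP: "((\<lambda>s. P (T - s)) has_vector_derivative - (E (T - s) *v c)) (at s within {0..T})"
    if "s \<in> {0..T}" for s
  proof -
    have "(P has_vector_derivative E (T - s) *v c) (at (T - s) within {0..T})"
      unfolding P_def using that by (intro integral_has_vector_derivative contEc) auto
    then have "(P has_vector_derivative E (T - s) *v c) (at (T - s) within (\<lambda>s. T - s) ` {0..T})"
      by (rule has_vector_derivative_within_subset) auto
    moreover have "((\<lambda>s. T - s) has_vector_derivative - 1) (at s within {0..T})"
      by (auto intro!: derivative_eq_intros simp: has_vector_derivative_def)
    ultimately show ?thesis
      using vector_diff_chain_within[of "\<lambda>s. T - s" "-1" s "{0..T}" P] by (simp add: o_def)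
  qed
  obtain L1 where "L1-lipschitz_on {0..T} (\<lambda>s. E (T - s))"
    using C1_imp_lipschitz[OF dE continuous_on_minus[OF bounded_bilinear.continuous_on[OF
          bounded_bilinear_matrix_matrix_mult continuous_on_const contE']]] by blast
  then obtain L2 where L2: "L2-lipschitz_on {0..T} (\<lambda>s. E (T - s) *v \<bar>z s\<bar>)"
    using lipschitz_on_bilinear[OF bounded_bilinear_matrix_vector_mult _ lipschitz_on_abs_vec[OF z]]
    by blast
  obtain L3 where L3: "L3-lipschitz_on {0..T} (\<lambda>s. P (T - s))"
    using C1_imp_lipschitz[OF dP contEc'] by blast
  have q: "(L2 + L3)-lipschitz_on {0..T} q"
    unfolding q_def by (rule lipschitz_on_add[OF L2 L3])
  \<comment> \<open>Outside \<open>N'\<close> every component of \<open>|z|\<close> is differentiable.\<close>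
  define N' where "N' = N \<union> (\<Union>i. {s\<in>{0..T}. z s $ i = 0 \<and>
      (\<exists>d. d \<noteq> 0 \<and> ((\<lambda>s. z s $ i) has_vector_derivative d) (at s within {0..T}))})"
  have "negligible N'"
    unfolding N'_def
    by (intro negligible_Un N negligible_countable countable_UN countable_simple_zeros) auto
  have "q T $ k \<le> q 0 $ k" for k
  proof (rule abs_continuous_nonincreasing[OF _ \<open>T \<ge> 0\<close> \<open>negligible N'\<close>])
    have "(L2 + L3)-lipschitz_on {0..T} (\<lambda>s. q s $ k)"
    proof (rule lipschitz_onI)
      fix s t assume "s \<in> {0..T}" "t \<in> {0..T}"
      then show "dist (q s $ k) (q t $ k) \<le> (L2 + L3) * dist s t"
        using lipschitz_onD[OF q] dist_vec_nth_le by (meson order_trans)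
    qed (rule lipschitz_on_nonneg[OF q])
    then show "abs_continuous_on {0..T} (\<lambda>s. q s $ k)"
      by (rule lipschitz_imp_abs_continuous_on)
    fix s assume s: "s \<in> {0..T} - N'"
    then obtain d where d: "(z has_vector_derivative d) (at s within {0..T})"
      and le: "\<And>i. sgn (z s $ i) * d $ i \<le> (A *v \<bar>z s\<bar> + c) $ i"
      using der[of s] by (auto simp: N'_def)
    define m where "m = (\<chi> i. sgn (z s $ i) * d $ i)"
    have "((\<lambda>s. \<bar>z s\<bar>) has_vector_derivative m) (at s within {0..T})"
    proof (rule has_vector_derivative_vecI)
      fix i
      have di: "((\<lambda>s. z s $ i) has_vector_derivative d $ i) (at s within {0..T})"
        using bounded_linear.has_vector_derivative[OF bounded_linear_vec_nth d] .
      then have "z s $ i = 0 \<Longrightarrow> d $ i = 0"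
        using s by (auto simp: N'_def)
      from has_vector_derivative_abs[OF di _ this] s
      show "((\<lambda>s. \<bar>z s\<bar> $ i) has_vector_derivative m $ i) (at s within {0..T})"
        by (simp add: m_def)
    qed
    then have "(q has_vector_derivative (E (T - s) *v m + - (A ** E (T - s)) *v \<bar>z s\<bar>) + - (E (T - s) *v c))
        (at s within {0..T})"
      unfolding q_def using s
      by (intro has_vector_derivative_add dP
          bounded_bilinear.has_vector_derivative[OF bounded_bilinear_matrix_vector_mult] dE) auto
    moreover have "(E (T - s) *v m + - (A ** E (T - s)) *v \<bar>z s\<bar>) + - (E (T - s) *v c)
        = - (E (T - s) *v ((A *v \<bar>z s\<bar> + c) - m))"
      using matrix_exp_commute[of A "T - s"]
      by (simp add: E_def matrix_vector_mult_diff_distrib matrix_vector_right_distrib matrix_vector_mul_assoc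
          bounded_bilinear.minus_left[OF bounded_bilinear_matrix_vector_mult])
    ultimately have "(q has_vector_derivative - (E (T - s) *v ((A *v \<bar>z s\<bar> + c) - m))) (at s within {0..T})"
      by (simp only:)
    from bounded_linear.has_vector_derivative[OF bounded_linear_vec_nth this, of k]
    have "((\<lambda>s. q s $ k) has_vector_derivative - (E (T - s) *v ((A *v \<bar>z s\<bar> + c) - m)) $ k) (at s within {0..T})"
      by simp
    moreover have "E (T - s) *v ((A *v \<bar>z s\<bar> + c) - m) \<ge> 0"
    proof (rule matrix_vector_mult_nonneg)
      show "E (T - s) $ i $ j \<ge> 0" for i j
        unfolding E_def using s by (intro matrix_exp_nonneg_metzler A) auto
      show "(A *v \<bar>z s\<bar> + c) - m \<ge> 0"
        using le by (simp add: less_eq_vec_def m_def)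
    qed
    ultimately show "\<exists>d\<le>0. ((\<lambda>s. q s $ k) has_vector_derivative d) (at s within {0..T})"
      by (intro exI[of _ "- (E (T - s) *v ((A *v \<bar>z s\<bar> + c) - m)) $ k"]) (auto simp: less_eq_vec_def)
  qed
  then have "q T \<le> q 0" by (simp add: less_eq_vec_def)
  then show ?thesis
    by (simp add: q_def E_def P_def matrix_exp_zero)
qed

section \<open>Solutions of the perturbed system\<close>

lemma AE_on_iff_negligible:
  "(AE t\<in>I in lebesgue. P t) \<longleftrightarrow> (\<exists>N. negligible N \<and> (\<forall>t\<in>I - N. P t))"
proof
  assume "AE t\<in>I in lebesgue. P t"
  then obtain N where "N \<in> null_sets lebesgue" "{t. \<not> (t \<in> I \<longrightarrow> P t)} \<subseteq> N"
    by (auto simp: eventually_ae_filter)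
  then show "\<exists>N. negligible N \<and> (\<forall>t\<in>I - N. P t)"
    by (auto simp: negligible_iff_null_sets intro!: exI[of _ N])
next
  assume "\<exists>N. negligible N \<and> (\<forall>t\<in>I - N. P t)"
  then obtain N where "negligible N" "\<forall>t\<in>I - N. P t" by auto
  then show "AE t\<in>I in lebesgue. P t"
    by (auto simp: eventually_ae_filter negligible_iff_null_sets intro!: bexI[of _ N])
qed

lemma abs_continuous_on_imp_continuous_on:
  fixes \<xi> :: "real \<Rightarrow> 'a::real_normed_vector"
  assumes "abs_continuous_on {a..b} \<xi>"
  shows "continuous_on {a..b} \<xi>"
  unfolding continuous_on_iff
proof (intro ballI allI impI)
  fix s e :: real assume s: "s \<in> {a..b}" and "e > 0"
  obtain \<delta> where "\<delta> > 0" and \<delta>: "\<And>d T. \<lbrakk>d division_of T; T \<subseteq> {a..b}; (\<Sum>k\<in>d. Sup k - Inf k) < \<delta>\<rbrakk>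
      \<Longrightarrow> (\<Sum>k\<in>d. norm (\<xi> (Sup k) - \<xi> (Inf k))) < e"
    using assms \<open>e > 0\<close> unfolding abs_continuous_on_def by meson
  show "\<exists>d>0. \<forall>t\<in>{a..b}. dist t s < d \<longrightarrow> dist (\<xi> t) (\<xi> s) < e"
  proof (intro exI[of _ \<delta>] conjI ballI impI)
    fix t assume t: "t \<in> {a..b}" "dist t s < \<delta>"
    \<comment> \<open>A single short interval is a division.\<close>
    let ?k = "{min s t..max s t}"
    have "{?k} division_of ?k"
      using division_of_self[of "min s t" "max s t"] by simp
    from \<delta>[OF this] have "norm (\<xi> (max s t) - \<xi> (min s t)) < e"
      using s t by (auto simp: dist_real_def)
    then show "dist (\<xi> t) (\<xi> s) < e"
      by (auto simp: dist_norm norm_minus_commute max_def min_def split: if_splits)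
  qed (fact \<open>\<delta> > 0\<close>)
qed

lemma solution_on_interval: "solution_on f W u I \<xi> \<Longrightarrow> is_interval I"
  by (simp add: solution_on_def)

lemma solution_on_derivative:
  assumes "solution_on f W u I \<xi>"
  obtains N where "negligible N"
    "\<And>t. t \<in> I - N \<Longrightarrow> \<exists>v. (\<xi> has_vector_derivative v) (at t within I) \<and> v \<in> (+) (f (\<xi> t) u) ` W"
  using assms unfolding solution_on_def AE_on_iff_negligible by blast

text \<open>
  A solution is continuous, hence bounded on a compact interval, and therefore so is its derivative
  \<open>f(\<xi>,u) + \<omega>\<close>.
\<close>

lemma solution_on_lipschitz:
  assumes sol: "solution_on f W u I \<xi>" and sub: "{a..b} \<subseteq> I"
    and f: "continuous_on UNIV (\<lambda>x. f x u)" and "bounded W"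
  shows "\<exists>L. L-lipschitz_on {a..b} \<xi>"
proof -
  have ac: "abs_continuous_on {a..b} \<xi>"
    using sol sub by (auto simp: solution_on_def loc_abs_continuous_on_def)
  then have "continuous_on {a..b} (\<lambda>t. f (\<xi> t) u)"
    by (intro continuous_on_compose2[OF f] abs_continuous_on_imp_continuous_on) auto
  then have "bounded ((\<lambda>t. f (\<xi> t) u) ` {a..b})"
    using compact_imp_bounded compact_continuous_image by blast
  then have "\<exists>B. \<forall>t\<in>{a..b}. norm (f (\<xi> t) u) \<le> B"
    by (simp add: bounded_iff)
  then obtain B where B: "\<And>t. t \<in> {a..b} \<Longrightarrow> norm (f (\<xi> t) u) \<le> B"
    by blast
  obtain C where C: "C > 0" "\<And>\<omega>. \<omega> \<in> W \<Longrightarrow> norm \<omega> \<le> C"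
    using \<open>bounded W\<close> by (auto simp: bounded_pos)
  obtain N where N: "negligible N"
    "\<And>t. t \<in> I - N \<Longrightarrow> \<exists>v. (\<xi> has_vector_derivative v) (at t within I) \<and> v \<in> (+) (f (\<xi> t) u) ` W"
    using solution_on_derivative[OF sol] by metis
  have "(\<bar>B\<bar> + C)-lipschitz_on {a..b} \<xi>"
  proof (rule abs_continuous_bounded_derivative_imp_lipschitz[OF ac N(1)])
    fix s assume s: "s \<in> {a..b} - N"
    then have "s \<in> I - N" using sub by blast
    from N(2)[OF this] obtain \<omega>
      where \<omega>: "\<omega> \<in> W" "(\<xi> has_vector_derivative f (\<xi> s) u + \<omega>) (at s within I)"
      by blast
    have "norm (f (\<xi> s) u + \<omega>) \<le> \<bar>B\<bar> + C"
      using norm_triangle_ineq[of "f (\<xi> s) u" \<omega>] B[of s] C(2)[OF \<omega>(1)] s by simp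
    then show "\<exists>d. norm d \<le> \<bar>B\<bar> + C \<and> (\<xi> has_vector_derivative d) (at s within {a..b})"
      using has_vector_derivative_within_subset[OF \<omega>(2) sub] by blast
  qed (use C in auto)
  then show ?thesis ..
qed

lemma solution_on_lipschitzI:
  assumes "is_interval I" and "\<And>a b. {a..b} \<subseteq> I \<Longrightarrow> \<exists>L. L-lipschitz_on {a..b} \<xi>" and "negligible N"
    and "\<And>t. t \<in> I - N \<Longrightarrow> \<exists>v. (\<xi> has_vector_derivative v) (at t within I) \<and> v \<in> (+) (f (\<xi> t) u) ` W"
  shows "solution_on f W u I \<xi>"
  unfolding solution_on_def loc_abs_continuous_on_def AE_on_iff_negligible
  using assms lipschitz_imp_abs_continuous_on by metis

lemma solution_on_subset:
  assumes sol: "solution_on f W u I \<xi>" and "J \<subseteq> I" "is_interval J"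
  shows "solution_on f W u J \<xi>"
proof -
  obtain N where N: "negligible N"
    "\<And>t. t \<in> I - N \<Longrightarrow> \<exists>v. (\<xi> has_vector_derivative v) (at t within I) \<and> v \<in> (+) (f (\<xi> t) u) ` W"
    using solution_on_derivative[OF sol] by metis
  have "\<exists>v. (\<xi> has_vector_derivative v) (at t within J) \<and> v \<in> (+) (f (\<xi> t) u) ` W" if "t \<in> J - N" for t
    using N(2)[of t] that \<open>J \<subseteq> I\<close> has_vector_derivative_within_subset by blast
  then show ?thesis
    using assms N(1) unfolding solution_on_def loc_abs_continuous_on_def AE_on_iff_negligible by blast
qed

lemma solution_on_mono:
  assumes sol: "solution_on f V u I \<xi>" and "V \<subseteq> W"
  shows "solution_on f W u I \<xi>"
  using assms unfolding solution_on_def by (auto elim!: eventually_mono)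

lemma has_vector_derivative_localize:
  assumes \<xi>: "(\<xi> has_vector_derivative v) (at t within I)" and "open G" "t \<in> G" "t \<in> J"
    and "I \<inter> G = J \<inter> G" and eq: "\<And>s. s \<in> J \<inter> G \<Longrightarrow> \<xi> s = \<eta> s"
  shows "(\<eta> has_vector_derivative v) (at t within J)"
proof -
  have "at t within I = at t within J"
    by (rule at_within_nhd[OF \<open>t \<in> G\<close> \<open>open G\<close>]) (use assms(5) in auto)
  moreover obtain d where "d > 0" "ball t d \<subseteq> G"
    using \<open>open G\<close> \<open>t \<in> G\<close> by (meson open_contains_ball)
  ultimately show ?thesis
    using \<xi> eq \<open>t \<in> J\<close> by (intro has_vector_derivative_transform_within[of \<xi> v t J d \<eta>])
      (auto simp: dist_commute subset_iff)
qed

lemma solution_on_cong: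
  assumes \<xi>: "solution_on f W u I \<xi>" and eq: "\<And>t. t \<in> I \<Longrightarrow> \<xi> t = \<eta> t"
    and f: "continuous_on UNIV (\<lambda>x. f x u)" and W: "bounded W"
  shows "solution_on f W u I \<eta>"
proof -
  obtain N where N: "negligible N" "\<And>t. t \<in> I - N \<Longrightarrow>
     \<exists>v. (\<xi> has_vector_derivative v) (at t within I) \<and> v \<in> (+) (f (\<xi> t) u) ` W"
    using solution_on_derivative[OF \<xi>] by metis
  show ?thesis
  proof (rule solution_on_lipschitzI[OF solution_on_interval[OF \<xi>] _ N(1)])
    fix a b assume ab: "{a..b} \<subseteq> I"
    from solution_on_lipschitz[OF \<xi> ab f W] obtain L where "L-lipschitz_on {a..b} \<xi>" ..
    then have "L-lipschitz_on {a..b} \<eta>"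
      by (rule lipschitz_on_transform) (use ab eq in auto)
    then show "\<exists>L. L-lipschitz_on {a..b} \<eta>" ..
  next
    fix t assume t: "t \<in> I - N"
    then obtain v where v: "(\<xi> has_vector_derivative v) (at t within I)" "v \<in> (+) (f (\<xi> t) u) ` W"
      using N(2) by blast
    have "(\<eta> has_vector_derivative v) (at t within I)"
      by (rule has_vector_derivative_localize[OF v(1), of UNIV]) (use t eq in auto)
    then show "\<exists>v. (\<eta> has_vector_derivative v) (at t within I) \<and> v \<in> (+) (f (\<eta> t) u) ` W"
      using v(2) t eq by auto
  qed
qed

lemma solution_on_concat:
  assumes \<xi>: "solution_on f W u {a..b} \<xi>" and \<eta>: "solution_on f W u {b..c} \<eta>" and "\<xi> b = \<eta> b"
    and f: "continuous_on UNIV (\<lambda>x. f x u)" and W: "bounded W"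
  shows "solution_on f W u {a..c} (\<lambda>t. if t \<le> b then \<xi> t else \<eta> t)" (is "solution_on _ _ _ _ ?\<zeta>")
proof -
  obtain L where L: "L-lipschitz_on {a..b} \<xi>" using solution_on_lipschitz[OF \<xi> _ f W] by blast
  obtain M where M: "M-lipschitz_on {b..c} \<eta>" using solution_on_lipschitz[OF \<eta> _ f W] by blast
  obtain N1 where N1: "negligible N1" "\<And>t. t \<in> {a..b} - N1 \<Longrightarrow>
      \<exists>v. (\<xi> has_vector_derivative v) (at t within {a..b}) \<and> v \<in> (+) (f (\<xi> t) u) ` W"
    using solution_on_derivative[OF \<xi>] by metis
  obtain N2 where N2: "negligible N2" "\<And>t. t \<in> {b..c} - N2 \<Longrightarrow>
      \<exists>v. (\<eta> has_vector_derivative v) (at t within {b..c}) \<and> v \<in> (+) (f (\<eta> t) u) ` W"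
    using solution_on_derivative[OF \<eta>] by metis
  show ?thesis
  proof (rule solution_on_lipschitzI)
    fix a' b' assume "{a'..b'} \<subseteq> {a..c}"
    then show "\<exists>L. L-lipschitz_on {a'..b'} ?\<zeta>"
      using lipschitz_on_subset[OF lipschitz_on_concat_max[OF L M \<open>\<xi> b = \<eta> b\<close>]] by blast
  next
    show "negligible (N1 \<union> N2 \<union> {b})" using N1 N2 by simp
  next
    fix t assume t: "t \<in> {a..c} - (N1 \<union> N2 \<union> {b})"
    show "\<exists>v. (?\<zeta> has_vector_derivative v) (at t within {a..c}) \<and> v \<in> (+) (f (?\<zeta> t) u) ` W"
    proof (cases "t < b")
      case True
      with t obtain v where v: "(\<xi> has_vector_derivative v) (at t within {a..b})" "v \<in> (+) (f (\<xi> t) u) ` W"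
        using N1(2)[of t] by auto
      show ?thesis
      proof (cases "b \<le> c")
        case bc: True
        have "(?\<zeta> has_vector_derivative v) (at t within {a..c})"
          by (rule has_vector_derivative_localize[OF v(1), of "{..<b}"]) (use True t bc in auto)
        then show ?thesis using v(2) True by auto
      next
        case bc: False
        have "(\<xi> has_vector_derivative v) (at t within {a..c})"
          by (rule has_vector_derivative_within_subset[OF v(1)]) (use bc in auto)
        then have "(?\<zeta> has_vector_derivative v) (at t within {a..c})"
          by (rule has_vector_derivative_transform_within[of _ _ _ _ 1]) (use t bc in auto)
        then show ?thesis using v(2) True by auto
      qed
    next
      case False
      then have "t > b" using t by auto
      with t obtain v where v: "(\<eta> has_vector_derivative v) (at t within {b..c})" "v \<in> (+) (f (\<eta> t) u) ` W"
        using N2(2)[of t] by auto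
      have "(?\<zeta> has_vector_derivative v) (at t within {a..c})"
      proof (cases "a \<le> b")
        case ab: True
        show ?thesis
          by (rule has_vector_derivative_localize[OF v(1), of "{b<..}"]) (use \<open>t > b\<close> t ab in auto)
      next
        case ab: False
        have "(\<eta> has_vector_derivative v) (at t within {a..c})"
          by (rule has_vector_derivative_within_subset[OF v(1)]) (use ab in auto)
        then show ?thesis
          by (rule has_vector_derivative_transform_within[of _ _ _ _ 1]) (use t ab in auto)
      qed
      then show ?thesis using v(2) \<open>t > b\<close> by auto
    qed
  qed (rule is_interval_cc)
qed

text \<open>
  The vector field is composed with the nearest point projection onto the ball. This extends it to the
  whole space with the same Lipschitz constant and the same bound \<open>M\<close>, so the integral operator is a
  contraction on all bounded continuous functions. The bound \<open>M \<delta> \<le> r\<close> keeps its fixed point inside the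
  ball, where the projection is the identity.
\<close>

lemma picard:
  fixes g :: "'a::euclidean_space \<Rightarrow> 'a"
  assumes g: "\<Lambda>-lipschitz_on (cball y r) g" and M: "\<And>x. x \<in> cball y r \<Longrightarrow> norm (g x) \<le> M"
    and "r \<ge> 0" "\<delta> \<ge> 0" and r: "M * \<delta> \<le> r" and contr: "\<Lambda> * \<delta> \<le> 1 / 2"
  shows "\<exists>x. x t0 = y \<and> (\<forall>t\<in>{t0..t0 + \<delta>}. (x has_vector_derivative g (x t)) (at t within {t0..t0 + \<delta>}))"
proof -
  define G where "G = (\<lambda>x. g (closest_point (cball y r) x))"
  define I where "I = {t0..t0 + \<delta>}"
  note \<Lambda> = lipschitz_on_nonneg[OF g]
  have cp: "closest_point (cball y r) x \<in> cball y r" for x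
    using \<open>r \<ge> 0\<close> by (intro closest_point_in_set) auto
  have Glip: "norm (G x - G x') \<le> \<Lambda> * norm (x - x')" for x x'
  proof -
    have "norm (G x - G x') \<le> \<Lambda> * dist (closest_point (cball y r) x) (closest_point (cball y r) x')"
      using lipschitz_onD[OF g cp cp] by (simp add: G_def dist_norm)
    also have "\<dots> \<le> \<Lambda> * dist x x'"
      using \<open>r \<ge> 0\<close> \<Lambda> by (intro mult_left_mono closest_point_lipschitz) auto
    finally show ?thesis by (simp add: dist_norm)
  qed
  have GM: "norm (G x) \<le> M" for x
    unfolding G_def by (rule M[OF cp])
  have contG: "continuous_on S G" for S
    by (rule lipschitz_on_continuous_on[of \<Lambda>], rule lipschitz_onI) (use Glip \<Lambda> in \<open>auto simp: dist_norm\<close>)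
  define F where "F = (\<lambda>x t. y + integral {t0..t} (\<lambda>s. G (apply_bcontfun x s)))" 
  have contGx: "continuous_on S (\<lambda>s. G (apply_bcontfun x s))" for S x
    by (rule continuous_on_compose2[OF contG continuous_on_apply_bcontfun]) auto
  have dF: "(F x has_vector_derivative G (apply_bcontfun x t)) (at t within I)" if "t \<in> I" for x t
    using integral_has_vector_derivative[OF contGx, of t t0 "t0 + \<delta>" x] that
    unfolding F_def I_def by (auto intro!: derivative_eq_intros simp: has_vector_derivative_add_const)
  have "continuous_on (cbox t0 (t0 + \<delta>)) (F x)" for x
    using dF unfolding I_def box_real by (rule continuous_on_vector_derivative)
  then have "\<exists>h::real \<Rightarrow>\<^sub>C 'a. \<forall>t. apply_bcontfun h t = F x (clamp t0 (t0 + \<delta>) t)" for x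
    by (metis continuous_on_cbox_bcontfunE)
  then obtain \<Phi> :: "(real \<Rightarrow>\<^sub>C 'a) \<Rightarrow> (real \<Rightarrow>\<^sub>C 'a)"
    where \<Phi>: "\<And>x t. apply_bcontfun (\<Phi> x) t = F x (clamp t0 (t0 + \<delta>) t)"
    by metis
  have clamp: "clamp t0 (t0 + \<delta>) t \<in> I" for t
    using clamp_in_interval[of t0 "t0 + \<delta>" t] \<open>\<delta> \<ge> 0\<close> by (simp add: I_def)
  have "dist (\<Phi> x) (\<Phi> x') \<le> 1 / 2 * dist x x'" for x x'
  proof (rule dist_bound)
    fix t
    define s where "s = clamp t0 (t0 + \<delta>) t"
    have s: "t0 \<le> s" "s \<le> t0 + \<delta>" using clamp[of t] by (auto simp: s_def I_def)
    have "dist (apply_bcontfun (\<Phi> x) t) (apply_bcontfun (\<Phi> x') t)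
        = norm (integral {t0..s} (\<lambda>s. G (apply_bcontfun x s) - G (apply_bcontfun x' s)))"
      unfolding \<Phi> F_def dist_norm s_def[symmetric]
      by (subst integral_diff) (auto intro!: integrable_continuous_real contGx)
    also have "\<dots> \<le> (\<Lambda> * dist x x') * (s - t0)"
    proof (rule integral_bound)
      show "continuous_on {t0..s} (\<lambda>s. G (apply_bcontfun x s) - G (apply_bcontfun x' s))"
        by (intro continuous_on_diff contGx)
      fix r
      show "norm (G (apply_bcontfun x r) - G (apply_bcontfun x' r)) \<le> \<Lambda> * dist x x'"
        using Glip[of "apply_bcontfun x r" "apply_bcontfun x' r"] mult_left_mono[OF dist_bounded[of x r x'] \<Lambda>]
        by (simp add: dist_norm)
    qed (fact s(1))
    also have "\<dots> \<le> (\<Lambda> * dist x x') * \<delta>"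
      using s \<Lambda> by (intro mult_left_mono) auto
    also have "\<dots> = (\<Lambda> * \<delta>) * dist x x'" by simp
    also have "\<dots> \<le> 1 / 2 * dist x x'"
      using contr by (intro mult_right_mono) auto
    finally show "dist (apply_bcontfun (\<Phi> x) t) (apply_bcontfun (\<Phi> x') t) \<le> 1 / 2 * dist x x'" .
  qed
  then have "\<exists>!x. \<Phi> x = x"
    by (intro banach_fix_type[of "1/2"]) auto
  then obtain x where x: "\<Phi> x = x" by blast
  have xF: "F x t = apply_bcontfun x t" if "t \<in> I" for t
  proof -
    have "clamp t0 (t0 + \<delta>) t = t"
      by (rule clamp_cancel_cbox) (use that in \<open>simp add: I_def\<close>)
    then show ?thesis using \<Phi>[of x t] x by simp
  qed
  have "(F x has_vector_derivative g (F x t)) (at t within I)" if "t \<in> I" for t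
  proof -
    have t: "t0 \<le> t" "t \<le> t0 + \<delta>" using that by (auto simp: I_def)
    have "M \<ge> 0" using GM[of y] norm_ge_zero order_trans by blast
    have "norm (F x t - y) \<le> M * (t - t0)"
      unfolding F_def using integral_bound[OF t(1) contGx GM] by simp
    also have "\<dots> \<le> M * \<delta>" using t \<open>M \<ge> 0\<close> by (intro mult_left_mono) auto
    also have "\<dots> \<le> r" by (rule r)
    finally have "F x t \<in> cball y r" by (simp add: dist_norm norm_minus_commute)
    then have "G (F x t) = g (F x t)" by (simp add: G_def closest_point_self)
    then show ?thesis using dF[OF that, of x] xF[OF that] by simp
  qed
  moreover have "F x t0 = y" by (simp add: F_def)
  ultimately show ?thesis unfolding I_def by blast
qed

lemma local_lipschitz_imp_lipschitz_on_compact: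
  fixes f :: "real^'n \<Rightarrow> real^'m \<Rightarrow> real^'n"
  assumes "local_lipschitz {u} UNIV (\<lambda>v x. f x v)" and "compact X"
  shows "\<exists>\<Lambda>. \<Lambda>-lipschitz_on X (\<lambda>x. f x u)"
  using local_lipschitz_compact_implies_lipschitz[of "{u}" X "\<lambda>v x. f x v"]
    local_lipschitz_subset[OF assms(1), of "{u}" X] assms(2)
  by (metis compact_insert compact_empty continuous_on_sing insertI1 order_refl subset_UNIV)

lemma local_lipschitz_imp_continuous_on:
  fixes f :: "real^'n \<Rightarrow> real^'m \<Rightarrow> real^'n"
  assumes "local_lipschitz {u} UNIV (\<lambda>v x. f x v)"
  shows "continuous_on UNIV (\<lambda>x. f x u)"
proof (rule continuous_at_imp_continuous_on, rule ballI)
  fix x :: "real^'n"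
  obtain \<Lambda> where "\<Lambda>-lipschitz_on (cball x 1) (\<lambda>x. f x u)"
    using local_lipschitz_imp_lipschitz_on_compact[OF assms compact_cball] by blast
  then have "continuous_on (cball x 1) (\<lambda>x. f x u)" by (rule lipschitz_on_continuous_on)
  then show "isCont (\<lambda>x. f x u) x"
    by (rule continuous_on_interior) simp
qed

text \<open>
  On the ball of radius \<open>R + 1\<close> the vector field has one Lipschitz constant and one bound, and each point of
  the ball of radius \<open>R\<close> has a unit ball around it inside the larger ball.
\<close>

lemma uniform_existence_time:
  fixes f :: "real^'n \<Rightarrow> real^'m \<Rightarrow> real^'n"
  assumes lip: "local_lipschitz {u} UNIV (\<lambda>v x. f x v)"
  shows "\<exists>\<delta>>0. \<forall>y\<in>cball x0 R. \<forall>t0. \<exists>\<xi>. \<xi> t0 = y \<and> solution_on f {0} u {t0..t0 + \<delta>} \<xi>"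
proof -
  obtain \<Lambda> where \<Lambda>: "\<Lambda>-lipschitz_on (cball x0 (R + 1)) (\<lambda>x. f x u)"
    using local_lipschitz_imp_lipschitz_on_compact[OF lip compact_cball] by blast
  have "bounded ((\<lambda>x. f x u) ` cball x0 (R + 1))"
    by (intro compact_imp_bounded compact_continuous_image compact_cball
        continuous_on_subset[OF local_lipschitz_imp_continuous_on[OF lip]]) auto
  then obtain M where M: "M > 0" "\<And>x. x \<in> cball x0 (R + 1) \<Longrightarrow> norm (f x u) \<le> M"
    by (auto simp: bounded_pos)
  define \<delta> where "\<delta> = min (1 / M) (1 / (2 * (\<Lambda> + 1)))"
  have "\<Lambda> \<ge> 0" using \<Lambda> by (rule lipschitz_on_nonneg)
  then have "\<delta> > 0" using \<open>M > 0\<close> by (simp add: \<delta>_def)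
  have "M * \<delta> \<le> M * (1 / M)"
    using \<open>M > 0\<close> by (intro mult_left_mono) (auto simp: \<delta>_def)
  then have M\<delta>: "M * \<delta> \<le> 1" using \<open>M > 0\<close> by simp
  have "\<delta> \<le> 1 / (2 * (\<Lambda> + 1))" by (simp add: \<delta>_def)
  then have "\<delta> * (2 * (\<Lambda> + 1)) \<le> 1"
    using \<open>\<Lambda> \<ge> 0\<close> by (subst (asm) pos_le_divide_eq) auto
  then have \<Lambda>\<delta>: "\<Lambda> * \<delta> \<le> 1 / 2" using \<open>\<delta> > 0\<close> by (simp add: algebra_simps)
  show ?thesis
  proof (intro exI[of _ \<delta>] conjI ballI allI)
    fix y t0 assume y: "y \<in> cball x0 R"
    have sub: "cball y 1 \<subseteq> cball x0 (R + 1)"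
      using y by (simp add: cball_subset_cball_iff dist_commute)
    obtain \<xi> where \<xi>: "\<xi> t0 = y"
      "\<And>t. t \<in> {t0..t0 + \<delta>} \<Longrightarrow> (\<xi> has_vector_derivative f (\<xi> t) u) (at t within {t0..t0 + \<delta>})"
      using picard[OF lipschitz_on_subset[OF \<Lambda> sub], of M \<delta> t0] M sub M\<delta> \<Lambda>\<delta> \<open>\<delta> > 0\<close> by (auto simp: subset_iff)
    have "continuous_on {t0..t0 + \<delta>} \<xi>"
      using \<xi>(2) by (rule continuous_on_vector_derivative)
    then have "continuous_on {t0..t0 + \<delta>} (\<lambda>t. f (\<xi> t) u)"
      by (intro continuous_on_compose2[OF local_lipschitz_imp_continuous_on[OF lip]]) auto
    then obtain L where L: "L-lipschitz_on {t0..t0 + \<delta>} \<xi>"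
      using C1_imp_lipschitz[OF \<xi>(2)] by blast
    have "solution_on f {0} u {t0..t0 + \<delta>} \<xi>"
    proof (rule solution_on_lipschitzI[where N = "{}"])
      show "\<exists>L. L-lipschitz_on {a..b} \<xi>" if "{a..b} \<subseteq> {t0..t0 + \<delta>}" for a b
        using lipschitz_on_subset[OF L that] ..
    qed (use \<xi>(2) is_interval_cc in auto)
    with \<xi>(1) show "\<exists>\<xi>. \<xi> t0 = y \<and> solution_on f {0} u {t0..t0 + \<delta>} \<xi>" by blast
  qed (fact \<open>\<delta> > 0\<close>)
qed

lemma unperturbed_solution_derivative:
  assumes "solution_on f {0} u I \<xi>"
  obtains N where "negligible N"
    "\<And>t. t \<in> I - N \<Longrightarrow> (\<xi> has_vector_derivative f (\<xi> t) u) (at t within I)"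
proof -
  obtain N where N: "negligible N"
    "\<And>t. t \<in> I - N \<Longrightarrow> \<exists>v. (\<xi> has_vector_derivative v) (at t within I) \<and> v \<in> (+) (f (\<xi> t) u) ` {0}"
    using solution_on_derivative[OF assms] by metis
  show thesis
  proof (rule that[OF N(1)])
    show "(\<xi> has_vector_derivative f (\<xi> t) u) (at t within I)" if "t \<in> I - N" for t
      using N(2)[OF that] by simp
  qed
qed

text \<open>
  If \<open>\<Lambda>\<close> is a Lipschitz constant of \<open>f(_,u)\<close> on a compact set that contains both solutions, then the
  squared distance can grow or shrink at most like \<open>exp(2\<Lambda>s)\<close> in either direction of time. The sign
  \<open>\<sigma>\<close> treats forward uniqueness (\<open>\<sigma> = 1\<close>) and backward uniqueness (\<open>\<sigma> = -1\<close>) together.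
\<close>

lemma distance_decay:
  fixes f :: "real^'n \<Rightarrow> real^'m \<Rightarrow> real^'n"
  assumes lip: "local_lipschitz {u} UNIV (\<lambda>v x. f x v)"
    and \<xi>: "solution_on f {0} u {a..b} \<xi>" and \<eta>: "solution_on f {0} u {a..b} \<eta>" and "a \<le> b"
  shows "\<exists>\<Lambda>. \<forall>\<sigma>\<in>{1, - 1}. \<sigma> * exp (- 2 * \<sigma> * \<Lambda> * b) * (norm (\<xi> b - \<eta> b))\<^sup>2
      \<le> \<sigma> * exp (- 2 * \<sigma> * \<Lambda> * a) * (norm (\<xi> a - \<eta> a))\<^sup>2"
proof -
  note f = local_lipschitz_imp_continuous_on[OF lip]
  obtain L where L: "L-lipschitz_on {a..b} \<xi>" using solution_on_lipschitz[OF \<xi> _ f] by auto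
  obtain M where M: "M-lipschitz_on {a..b} \<eta>" using solution_on_lipschitz[OF \<eta> _ f] by auto
  have "compact (\<xi> ` {a..b} \<union> \<eta> ` {a..b})"
    using lipschitz_on_continuous_on[OF L] lipschitz_on_continuous_on[OF M]
    by (intro compact_Un compact_continuous_image compact_Icc)
  then obtain \<Lambda> where \<Lambda>: "\<Lambda>-lipschitz_on (\<xi> ` {a..b} \<union> \<eta> ` {a..b}) (\<lambda>x. f x u)"
    using local_lipschitz_imp_lipschitz_on_compact[OF lip] by blast
  define z where "z = (\<lambda>t. \<xi> t - \<eta> t)"
  have z: "(L + M)-lipschitz_on {a..b} z"
    unfolding z_def by (rule lipschitz_on_diff[OF L M])
  obtain N1 where N1: "negligible N1" "\<And>t. t \<in> {a..b} - N1 \<Longrightarrow>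
      (\<xi> has_vector_derivative f (\<xi> t) u) (at t within {a..b})"
    using unperturbed_solution_derivative[OF \<xi>] by metis
  obtain N2 where N2: "negligible N2" "\<And>t. t \<in> {a..b} - N2 \<Longrightarrow>
      (\<eta> has_vector_derivative f (\<eta> t) u) (at t within {a..b})"
    using unperturbed_solution_derivative[OF \<eta>] by metis
  have "\<sigma> * exp (- 2 * \<sigma> * \<Lambda> * b) * (z b \<bullet> z b) \<le> \<sigma> * exp (- 2 * \<sigma> * \<Lambda> * a) * (z a \<bullet> z a)"
    if \<sigma>: "\<sigma> \<in> {1, - 1}" for \<sigma> :: real
  proof (rule abs_continuous_nonincreasing[where q = "\<lambda>s. \<sigma> * exp (- 2 * \<sigma> * \<Lambda> * s) * (z s \<bullet> z s)"
        and N = "N1 \<union> N2", OF _ \<open>a \<le> b\<close>])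
    have de: "((\<lambda>s. \<sigma> * exp (- 2 * \<sigma> * \<Lambda> * s)) has_vector_derivative
        \<sigma> * (exp (- 2 * \<sigma> * \<Lambda> * s) * (- 2 * \<sigma> * \<Lambda>))) (at s within S)" for s S
      unfolding has_real_derivative_iff_has_vector_derivative[symmetric]
      by (auto intro!: derivative_eq_intros)
    obtain L1 where L1: "L1-lipschitz_on {a..b} (\<lambda>s. \<sigma> * exp (- 2 * \<sigma> * \<Lambda> * s))"
      using C1_imp_lipschitz[OF de] by (force intro: continuous_intros)
    obtain L2 where L2: "L2-lipschitz_on {a..b} (\<lambda>s. z s \<bullet> z s)"
      using lipschitz_on_bilinear[OF bounded_bilinear_inner z z] by blast
    show "abs_continuous_on {a..b} (\<lambda>s. \<sigma> * exp (- 2 * \<sigma> * \<Lambda> * s) * (z s \<bullet> z s))"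
      using lipschitz_on_bilinear[OF bounded_bilinear_mult L1 L2] lipschitz_imp_abs_continuous_on by blast
    show "negligible (N1 \<union> N2)" using N1 N2 by simp
    fix s assume s: "s \<in> {a..b} - (N1 \<union> N2)"
    define d where "d = f (\<xi> s) u - f (\<eta> s) u"
    have "(z has_vector_derivative d) (at s within {a..b})"
      unfolding z_def d_def using s N1(2)[of s] N2(2)[of s] by (intro has_vector_derivative_diff) auto
    from bounded_bilinear.has_vector_derivative[OF bounded_bilinear_mult de
        bounded_bilinear.has_vector_derivative[OF bounded_bilinear_inner this this]]
    have "((\<lambda>s. \<sigma> * exp (- 2 * \<sigma> * \<Lambda> * s) * (z s \<bullet> z s)) has_vector_derivative
        2 * exp (- 2 * \<sigma> * \<Lambda> * s) * (\<sigma> * (z s \<bullet> d) - \<sigma> * \<sigma> * \<Lambda> * (z s \<bullet> z s))) (at s within {a..b})"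
      by (simp add: inner_commute algebra_simps)
    moreover have "\<sigma> * (z s \<bullet> d) - \<sigma> * \<sigma> * \<Lambda> * (z s \<bullet> z s) \<le> 0"
    proof -
      have "norm d \<le> \<Lambda> * norm (z s)"
        using lipschitz_on_normD[OF \<Lambda>, of "\<xi> s" "\<eta> s"] s by (simp add: d_def z_def)
      then have "norm (z s) * norm d \<le> norm (z s) * (\<Lambda> * norm (z s))"
        by (intro mult_left_mono) auto
      then have "\<bar>z s \<bullet> d\<bar> \<le> \<Lambda> * (z s \<bullet> z s)"
        using Cauchy_Schwarz_ineq2[of "z s" d] by (simp add: dot_square_norm power2_eq_square mult_ac)
      then show ?thesis using \<sigma> by auto
    qed
    ultimately show "\<exists>d\<le>0. ((\<lambda>s. \<sigma> * exp (- 2 * \<sigma> * \<Lambda> * s) * (z s \<bullet> z s)) has_vector_derivative d) (at s within {a..b})"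
      by (intro exI conjI) (auto intro: mult_nonneg_nonpos)
  qed
  then show ?thesis
    unfolding z_def dot_square_norm by blast
qed

lemma solution_unique:
  fixes f :: "real^'n \<Rightarrow> real^'m \<Rightarrow> real^'n"
  assumes lip: "local_lipschitz {u} UNIV (\<lambda>v x. f x v)"
    and \<xi>: "solution_on f {0} u I \<xi>" and \<eta>: "solution_on f {0} u I \<eta>"
    and "s \<in> I" "t \<in> I" and eq: "\<xi> s = \<eta> s"
  shows "\<xi> t = \<eta> t"
proof -
  have min_le_max: "min s t \<le> max s t" by simp
  have sub: "{min s t..max s t} \<subseteq> I"
  proof
    fix r assume "r \<in> {min s t..max s t}"
    moreover have "min s t \<in> I" "max s t \<in> I"
      using \<open>s \<in> I\<close> \<open>t \<in> I\<close> by (simp_all add: min_def max_def)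
    ultimately show "r \<in> I"
      using mem_is_interval_1_I[OF solution_on_interval[OF \<xi>], of "min s t" "max s t" r] by simp
  qed
  obtain \<Lambda> where \<Lambda>: "\<forall>\<sigma>\<in>{1, - 1}.
      \<sigma> * exp (- 2 * \<sigma> * \<Lambda> * max s t) * (norm (\<xi> (max s t) - \<eta> (max s t)))\<^sup>2
      \<le> \<sigma> * exp (- 2 * \<sigma> * \<Lambda> * min s t) * (norm (\<xi> (min s t) - \<eta> (min s t)))\<^sup>2"
    using distance_decay[OF lip solution_on_subset[OF \<xi> sub is_interval_cc]
        solution_on_subset[OF \<eta> sub is_interval_cc] min_le_max] ..
  show ?thesis
  proof (cases "s \<le> t")
    case True
    then have "exp (- 2 * \<Lambda> * t) * (norm (\<xi> t - \<eta> t))\<^sup>2 \<le> 0"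
      using bspec[OF \<Lambda>, of 1] eq by (simp add: min_def max_def)
    then show ?thesis by (simp add: mult_le_0_iff)
  next
    case False
    then have "exp (2 * \<Lambda> * t) * (norm (\<xi> t - \<eta> t))\<^sup>2 \<le> 0"
      using bspec[OF \<Lambda>, of "- 1"] eq by (simp add: min_def max_def)
    then show ?thesis by (simp add: mult_le_0_iff)
  qed
qed

section \<open>The general solution\<close>

text \<open>
  The union of all solutions through \<open>(0,p)\<close> is well defined by uniqueness and is itself a solution. Every
  other solution through \<open>(0,p)\<close> is a restriction of it, so it is the only one that cannot be continued,
  and it is the value of the definite description in \<open>general_solution\<close>.
\<close>

lemma general_solution_extends:
  fixes f :: "real^'n \<Rightarrow> real^'m \<Rightarrow> real^'n"
  assumes lip: "local_lipschitz {u} UNIV (\<lambda>v x. f x v)"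
    and sol: "solution_on f {0} u I \<xi>" and "0 \<in> I"
  shows "I \<subseteq> dom (general_solution f u (\<xi> 0))" (is ?dom)
    and "\<forall>t\<in>I. the (general_solution f u (\<xi> 0) t) = \<xi> t" (is ?val)
proof -
  define p where "p = \<xi> 0"
  note f = local_lipschitz_imp_continuous_on[OF lip]
  define S where "S J \<eta> \<longleftrightarrow> solution_on f {0} u J \<eta> \<and> 0 \<in> J \<and> \<eta> 0 = p" for J \<eta>
  define D where "D = \<Union>{J. \<exists>\<eta>. S J \<eta>}"
  define \<phi> where "\<phi> t = (SOME v. \<exists>J \<eta>. S J \<eta> \<and> t \<in> J \<and> v = \<eta> t)" for t
  have int: "is_interval J" if "S J \<eta>" for J \<eta>
    using that solution_on_interval by (auto simp: S_def)
  have agree: "\<eta> t = \<eta>' t" if "S J \<eta>" "S J' \<eta>'" "t \<in> J" "t \<in> J'" for J J' \<eta> \<eta>' t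
  proof (rule solution_unique[OF lip, of "J \<inter> J'" \<eta> \<eta>' 0 t])
    show "solution_on f {0} u (J \<inter> J') \<eta>" "solution_on f {0} u (J \<inter> J') \<eta>'"
      using that int[OF that(1)] int[OF that(2)]
      by (auto simp: S_def intro: solution_on_subset is_interval_Int)
  qed (use that in \<open>auto simp: S_def\<close>)
  have \<phi>: "\<phi> t = \<eta> t" if "S J \<eta>" "t \<in> J" for J \<eta> t
  proof -
    have "\<exists>J \<eta>. S J \<eta> \<and> t \<in> J \<and> \<phi> t = \<eta> t"
      unfolding \<phi>_def by (rule someI_ex) (use that in blast)
    then show ?thesis using agree that by metis
  qed
  have D: "\<exists>J \<eta>. S J \<eta> \<and> t \<in> J" if "t \<in> D" for t
    using that by (auto simp: D_def)
  have sub: "J \<subseteq> D" if "S J \<eta>" for J \<eta>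
    using that by (auto simp: D_def)
  have S\<xi>: "S I \<xi>" using sol \<open>0 \<in> I\<close> by (simp add: S_def p_def)
  then have "0 \<in> D" using sub \<open>0 \<in> I\<close> by blast
  have "is_interval D"
    unfolding is_interval_connected_1 D_def
    by (rule connected_Union) (use int in \<open>auto simp: is_interval_connected_1 S_def\<close>)
  then have Dint: "x \<in> D" if "a \<in> D" "b \<in> D" "a \<le> x" "x \<le> b" for a b x
    using mem_is_interval_1_I[OF \<open>is_interval D\<close>] that by blast
  have lipJ: "\<exists>L. L-lipschitz_on {a..b} \<phi>" if SJ: "S J \<eta>" and ab: "{a..b} \<subseteq> J" for J \<eta> a b
  proof -
    have "solution_on f {0} u J \<eta>" using SJ by (simp add: S_def)
    from solution_on_lipschitz[OF this ab f] obtain L where L: "L-lipschitz_on {a..b} \<eta>"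
      by auto
    then have "L-lipschitz_on {a..b} \<phi>"
      by (rule lipschitz_on_transform) (use \<phi>[OF SJ] ab in auto)
    then show ?thesis ..
  qed
  have "\<exists>J \<eta>. r \<in> \<rat> \<inter> D \<longrightarrow> S J \<eta> \<and> r \<in> J" for r
    using D by blast
  then obtain J \<eta> where J: "\<And>r. r \<in> \<rat> \<inter> D \<Longrightarrow> S (J r) (\<eta> r) \<and> r \<in> J r"
    by metis
  have "\<exists>N. r \<in> \<rat> \<inter> D \<longrightarrow> negligible N \<and> (\<forall>t\<in>J r - N. (\<eta> r has_vector_derivative f (\<eta> r t) u) (at t within J r))" for r
    using J[of r] unfolding S_def by (metis unperturbed_solution_derivative)
  then obtain N where N: "\<And>r. r \<in> \<rat> \<inter> D \<Longrightarrow> negligible (N r)"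
    "\<And>r t. r \<in> \<rat> \<inter> D \<Longrightarrow> t \<in> J r - N r \<Longrightarrow> (\<eta> r has_vector_derivative f (\<eta> r t) u) (at t within J r)"
    by metis
  \<comment> \<open>Countably many solutions, those that reach the rational points of \<open>D\<close>, cover all of \<open>D\<close> except
    possibly its end points. So the exceptional sets still have a negligible union.\<close>
  define Z where "Z = (\<Union>r\<in>\<rat> \<inter> D. N r) \<union> {0} \<union> ({t\<in>D. \<forall>s\<in>D. s \<le> t} \<union> {t\<in>D. \<forall>s\<in>D. t \<le> s})"
  have sol\<phi>: "solution_on f {0} u D \<phi>"
  proof (rule solution_on_lipschitzI[OF \<open>is_interval D\<close>])
    fix a b assume ab: "{a..b} \<subseteq> D"
    show "\<exists>L. L-lipschitz_on {a..b} \<phi>"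
    proof (cases "a \<le> b")
      case False
      then have "0-lipschitz_on {a..b} \<phi>" by simp
      then show ?thesis ..
    next
      case True
      then obtain J1 \<eta>1 J2 \<eta>2 where S: "S J1 \<eta>1" "a \<in> J1" "S J2 \<eta>2" "b \<in> J2"
        using D[of a] D[of b] ab by force
      have J1: "x \<in> J1" if "min a 0 \<le> x" "x \<le> max a 0" for x
        using mem_is_interval_1_I[OF int[OF S(1)], of "min a 0" "max a 0" x] S(1,2) that
        by (auto simp: S_def max_def min_def split: if_splits)
      have J2: "x \<in> J2" if "min b 0 \<le> x" "x \<le> max b 0" for x
        using mem_is_interval_1_I[OF int[OF S(3)], of "min b 0" "max b 0" x] S(3,4) that
        by (auto simp: S_def max_def min_def split: if_splits)
      consider "0 \<le> a" | "b \<le> 0" | "a < 0" "0 < b" by linarith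
      then show ?thesis
      proof cases
        case 1
        then show ?thesis by (intro lipJ[OF S(3)]) (use J2 True in auto)
      next
        case 2
        then show ?thesis by (intro lipJ[OF S(1)]) (use J1 True in auto)
      next
        case 3
        obtain L1 where L1: "L1-lipschitz_on {a..0} \<phi>" using lipJ[OF S(1), of a 0] J1 3 by force
        obtain L2 where L2: "L2-lipschitz_on {0..b} \<phi>" using lipJ[OF S(3), of 0 b] J2 3 by force
        show ?thesis using lipschitz_on_concat_max[OF L1 L2] by auto
      qed
    qed
  next
    have "{t\<in>D. \<forall>s\<in>D. s \<le> t} \<subseteq> {Sup D}" "{t\<in>D. \<forall>s\<in>D. t \<le> s} \<subseteq> {Inf D}"
      by (auto intro!: cSup_eq_maximum[symmetric] cInf_eq_minimum[symmetric])
    then have "negligible {t\<in>D. \<forall>s\<in>D. s \<le> t}" "negligible {t\<in>D. \<forall>s\<in>D. t \<le> s}"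
      using negligible_subset negligible_sing by blast+
    moreover have "negligible (\<Union>r\<in>\<rat> \<inter> D. N r)"
      by (intro negligible_countable_Union) (use N countable_rat in auto)
    ultimately show "negligible Z" by (simp add: Z_def)
  next
    fix t assume t: "t \<in> D - Z"
    obtain r G where r: "r \<in> \<rat> \<inter> D" and G: "open G" "t \<in> G" "G \<subseteq> J r"
    proof (cases "t > 0")
      case True
      obtain s where "s \<in> D" "t < s" using t by (auto simp: Z_def not_le)
      then obtain r where r: "r \<in> \<rat>" "t < r" "r < s" using Rats_dense_in_real by blast
      then have rD: "r \<in> \<rat> \<inter> D" using Dint[of t s r] t \<open>s \<in> D\<close> by auto
      have "{0<..<r} \<subseteq> J r"
        using J[OF rD] mem_is_interval_1_I[OF int[of "J r" "\<eta> r"], of 0 r]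
        by (auto simp: S_def)
      then show ?thesis using that[OF rD, of "{0<..<r}"] r True by auto
    next
      case False
      then have "t < 0" using t by (auto simp: Z_def)
      obtain s where "s \<in> D" "s < t" using t by (auto simp: Z_def not_le)
      then obtain r where r: "r \<in> \<rat>" "s < r" "r < t" using Rats_dense_in_real by blast
      then have rD: "r \<in> \<rat> \<inter> D" using Dint[of s t r] t \<open>s \<in> D\<close> by auto
      have "{r<..<0} \<subseteq> J r"
        using J[OF rD] mem_is_interval_1_I[OF int[of "J r" "\<eta> r"], of r 0]
        by (auto simp: S_def)
      then show ?thesis using that[OF rD, of "{r<..<0}"] r \<open>t < 0\<close> by auto
    qed
    have "G \<subseteq> D" using G(3) sub J[OF r] by blast
    have "(\<eta> r has_vector_derivative f (\<eta> r t) u) (at t within J r)"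
      using N(2)[OF r] t r G by (auto simp: Z_def)
    then have "(\<phi> has_vector_derivative f (\<eta> r t) u) (at t within D)"
      by (rule has_vector_derivative_localize[OF _ G(1,2)])
         (use t G \<open>G \<subseteq> D\<close> \<phi> J[OF r] in auto)
    moreover have "\<phi> t = \<eta> r t" using \<phi> J[OF r] G by blast
    ultimately show "\<exists>v. (\<phi> has_vector_derivative v) (at t within D) \<and> v \<in> (+) (f (\<phi> t) u) ` {0}"
      by auto
  qed
  have "\<phi> 0 = p" using \<phi>[OF S\<xi> \<open>0 \<in> I\<close>] by (simp add: p_def)
  define g where "g t = (if t \<in> D then Some (\<phi> t) else None)" for t
  have domg: "dom g = D" by (auto simp: g_def split: if_splits)
  have cong: "solution_on f {0} u D (\<lambda>t. the (g t))"
    by (rule solution_on_cong[OF sol\<phi> _ f]) (auto simp: g_def)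
  have max: "noncontinuable_solution f u p (dom g) (\<lambda>t. the (g t))"
    unfolding noncontinuable_solution_def domg
  proof (intro conjI allI impI notI)
    show "solution_on f {0} u D (\<lambda>t. the (g t))" by (rule cong)
    show "0 \<in> D" by fact
    then show "the (g 0) = p" using \<open>\<phi> 0 = p\<close> by (simp add: g_def)
    fix J assume J: "is_interval J \<and> D \<subset> J" and "continuable_to f {0} u D (\<lambda>t. the (g t)) J"
    then obtain \<eta> where "solution_on f {0} u J \<eta>" "\<forall>t\<in>D. \<eta> t = the (g t)"
      by (auto simp: continuable_to_def)
    then have "S J \<eta>"
      using \<open>0 \<in> D\<close> \<open>the (g 0) = p\<close> J by (auto simp: S_def)
    then show False using sub J by blast
  qed
  have "general_solution f u p = g"
    unfolding general_solution_def
  proof (rule the_equality)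
    show "noncontinuable_solution f u p (dom g) (\<lambda>t. the (g t))" by (rule max)
    fix g' assume g': "noncontinuable_solution f u p (dom g') (\<lambda>t. the (g' t))"
    then have S': "S (dom g') (\<lambda>t. the (g' t))"
      by (simp add: S_def noncontinuable_solution_def)
    then have eq: "g' t = g t" if "t \<in> dom g'" for t
      using \<phi>[OF S' that] sub[OF S'] that by (auto simp: g_def)
    have "\<not> dom g' \<subset> D"
    proof
      assume "dom g' \<subset> D"
      moreover have "continuable_to f {0} u (dom g') (\<lambda>t. the (g' t)) D"
        unfolding continuable_to_def using cong eq by (intro exI[of _ "\<lambda>t. the (g t)"]) auto
      ultimately show False
        using g' \<open>is_interval D\<close> by (auto simp: noncontinuable_solution_def)
    qed
    then have "dom g' = dom g" using sub[OF S'] domg by blast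
    then show "g' = g" using eq by (metis domIff ext)
  qed
  then show ?dom ?val
    using domg sub[OF S\<xi>] \<phi>[OF S\<xi>] by (auto simp: p_def[symmetric] g_def)
qed

section \<open>The growth bound\<close>

text \<open>
  The mean value theorem along the segment from \<open>y\<close> to \<open>x\<close>, which lies in \<open>K'\<close> by convexity, writes the
  left-hand side as the sum of \<open>sgn(z_i) z_j D_j g_i(p)\<close> over \<open>j\<close>. For \<open>j = i\<close> the factor \<open>sgn(z_i) z_i\<close> is
  \<open>|z_i|\<close>, so an upper bound on \<open>D_i g_i(p)\<close> is enough, whatever its sign.
\<close>

lemma one_sided_estimate:
  fixes g :: "real^'n \<Rightarrow> real^'n" and A :: "real^'n^'n"
  assumes g: "continuously_differentiable g" and "convex K'" and x: "x \<in> K'" and y: "y \<in> K'"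
    and A: "\<And>x i j. x \<in> K' \<Longrightarrow> A $ i $ j \<ge> (if i = j then partial_deriv j (\<lambda>y. g y $ i) x
                          else \<bar>partial_deriv j (\<lambda>y. g y $ i) x\<bar>)"
  shows "sgn ((x - y) $ i) * (g x - g y) $ i \<le> (A *v \<bar>x - y\<bar>) $ i"
proof -
  obtain g' :: "real^'n \<Rightarrow> (real^'n) \<Rightarrow>\<^sub>L (real^'n)"
    where g': "\<And>x. (g has_derivative blinfun_apply (g' x)) (at x)"
    using g unfolding continuously_differentiable_def by blast
  have comp: "((\<lambda>t. g (p + t *\<^sub>R v) $ i) has_real_derivative blinfun_apply (g' (p + t *\<^sub>R v)) v $ i) (at t)" for p v t i
  proof -
    have "((\<lambda>t. p + t *\<^sub>R v) has_derivative (\<lambda>h. h *\<^sub>R v)) (at t)"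
      by (auto intro!: derivative_eq_intros)
    from has_derivative_compose[OF this g']
    have "((\<lambda>t. g (p + t *\<^sub>R v) $ i) has_derivative (\<lambda>h. blinfun_apply (g' (p + t *\<^sub>R v)) (h *\<^sub>R v) $ i)) (at t)"
      by (rule bounded_linear.has_derivative[OF bounded_linear_vec_nth])
    then show ?thesis
      by (simp add: has_field_derivative_def blinfun.scaleR_right mult_commute_abs)
  qed
  have pd: "partial_deriv j (\<lambda>y. g y $ i) p = blinfun_apply (g' p) (axis j 1) $ i" for j p i
    unfolding partial_deriv_def using comp[of p "axis j 1" i 0] by (intro DERIV_imp_deriv) simp
  define z where "z = x - y"
  obtain t :: real where t: "0 < t" "t < 1"
    and mvt: "g (y + 1 *\<^sub>R z) $ i - g (y + 0 *\<^sub>R z) $ i = (1 - 0) * (blinfun_apply (g' (y + t *\<^sub>R z)) z $ i)"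
    using MVT2[of 0 1 "\<lambda>t. g (y + t *\<^sub>R z) $ i" "\<lambda>t. blinfun_apply (g' (y + t *\<^sub>R z)) z $ i"] comp by auto
  define p where "p = y + t *\<^sub>R z"
  have "p = (1 - t) *\<^sub>R y + t *\<^sub>R x" by (simp add: p_def z_def algebra_simps)
  then have "p \<in> K'"
    using convexD_alt[OF \<open>convex K'\<close> y x, of t] t by simp
  have "z = (\<Sum>j\<in>UNIV. z $ j *\<^sub>R axis j 1)"
    using basis_expansion[of z] by (simp add: scalar_mult_eq_scaleR)
  then have "blinfun_apply (g' p) z = (\<Sum>j\<in>UNIV. z $ j *\<^sub>R blinfun_apply (g' p) (axis j 1))"
    by (metis (no_types, lifting) blinfun.sum_right blinfun.scaleR_right sum.cong)
  then have "(g x - g y) $ i = (\<Sum>j\<in>UNIV. z $ j * partial_deriv j (\<lambda>y. g y $ i) p)"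
    using mvt by (simp add: z_def p_def pd sum_component)
  then have "sgn (z $ i) * (g x - g y) $ i = (\<Sum>j\<in>UNIV. sgn (z $ i) * z $ j * partial_deriv j (\<lambda>y. g y $ i) p)"
    by (simp add: sum_distrib_left mult.assoc)
  also have "\<dots> \<le> (\<Sum>j\<in>UNIV. A $ i $ j * \<bar>z $ j\<bar>)"
  proof (rule sum_mono)
    fix j
    let ?D = "partial_deriv j (\<lambda>y. g y $ i) p"
    show "sgn (z $ i) * z $ j * ?D \<le> A $ i $ j * \<bar>z $ j\<bar>"
    proof (cases "j = i")
      case True
      then have "sgn (z $ i) * z $ j = \<bar>z $ j\<bar>" by (simp add: abs_sgn mult.commute)
      moreover have "?D \<le> A $ i $ j" using A[OF \<open>p \<in> K'\<close>, of i j] True by simp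
      ultimately show ?thesis by (simp add: mult.commute mult_left_mono)
    next
      case False
      have "sgn (z $ i) * z $ j * ?D \<le> \<bar>sgn (z $ i)\<bar> * \<bar>z $ j\<bar> * \<bar>?D\<bar>"
        by (metis abs_ge_self abs_mult)
      also have "\<dots> \<le> 1 * \<bar>z $ j\<bar> * A $ i $ j"
        using A[OF \<open>p \<in> K'\<close>, of i j] False
        by (intro mult_mono) (auto simp: abs_sgn_eq)
      finally show ?thesis by (simp add: mult.commute)
    qed
  qed
  finally show ?thesis by (simp add: z_def matrix_vector_mult_def)
qed

text \<open>
  The hypotheses of the theorem for a single input \<open>u\<close>, with \<open>A = L(u)\<close>.
\<close>

locale reach_setting =
  fixes f :: "real^'n \<Rightarrow> real^'m \<Rightarrow> real^'n" and u :: "real^'m" and w :: "real^'n"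
    and K K' :: "(real^'n) set" and A :: "real^'n^'n" and \<tau> :: real
  assumes \<tau>: "\<tau> > 0" and lip: "local_lipschitz {u} UNIV (\<lambda>v x. f x v)"
    and w: "w \<ge> 0" and C1: "continuously_differentiable (\<lambda>x. f x u)"
    and KK': "K \<subseteq> K'" and ne: "K' \<noteq> {}" and conv: "convex K'"
    and stay: "\<And>\<tau>' \<xi> t. \<lbrakk>\<tau>' \<in> {0..\<tau>}; solution_on f (cbox (- w) w) u {0..\<tau>'} \<xi>; \<xi> 0 \<in> K; t \<in> {0..\<tau>'}\<rbrakk> \<Longrightarrow> \<xi> t \<in> K'"
    and A: "\<And>x i j. x \<in> K' \<Longrightarrow> A $ i $ j \<ge> (if i = j then partial_deriv j (\<lambda>y. f y u $ i) x
                          else \<bar>partial_deriv j (\<lambda>y. f y u $ i) x\<bar>)"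
begin

abbreviation "W \<equiv> cbox (- w) w"

lemma f_cont: "continuous_on UNIV (\<lambda>x. f x u)"
  by (rule local_lipschitz_imp_continuous_on[OF lip])

lemma metzler_A: "metzler A"
  unfolding metzler_def
proof (intro allI impI)
  fix i j :: 'n assume "i \<noteq> j"
  obtain x where "x \<in> K'" using ne by blast
  from A[OF this, of i j] show "A $ i $ j \<ge> 0" using \<open>i \<noteq> j\<close> by simp
qed

lemma perturbation_bound:
  assumes "\<omega> \<in> W" and "\<bar>s\<bar> \<le> 1"
  shows "s * \<omega> $ i \<le> w $ i"
proof -
  have "\<bar>\<omega> $ i\<bar> \<le> w $ i" using assms(1) unfolding mem_box_cart by (simp add: abs_le_iff minus_le_iff)
  moreover have "s * \<omega> $ i \<le> \<bar>s\<bar> * \<bar>\<omega> $ i\<bar>" by (metis abs_ge_self abs_mult)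
  moreover have "\<bar>s\<bar> * \<bar>\<omega> $ i\<bar> \<le> 1 * \<bar>\<omega> $ i\<bar>" using assms(2) by (intro mult_right_mono) auto
  ultimately show ?thesis by linarith
qed

text \<open>
  The comparison of a solution with its constant initial value: their difference is driven by
  \<open>|f(x_0,u)| + w\<close>. A priori bounds on \<open>K'\<close> itself are not available, since \<open>K'\<close> may be unbounded.
\<close>

lemma solution_from_K_bounded:
  assumes x0: "x0 \<in> K"
  shows "\<exists>R. \<forall>t\<in>{0..\<tau>}. \<forall>\<xi>. solution_on f W u {0..t} \<xi> \<and> \<xi> 0 = x0 \<longrightarrow> \<xi> t \<in> cball x0 R"
proof -
  define c where "c = \<bar>f x0 u\<bar> + w"
  define P where "P = (\<lambda>t. integral {0..t} (\<lambda>s. matrix_exp (s *\<^sub>R A) *v c))"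
  have "continuous_on {0..\<tau>} (\<lambda>s. matrix_exp (s *\<^sub>R A) *v c)"
    by (rule bounded_bilinear.continuous_on[OF bounded_bilinear_matrix_vector_mult continuous_on_matrix_exp continuous_on_const])
  then have "continuous_on {0..\<tau>} P"
    unfolding P_def by (intro indefinite_integral_continuous_1 integrable_continuous_real)
  then have "bounded (P ` {0..\<tau>})"
    using compact_imp_bounded compact_continuous_image by blast
  then have "\<exists>R. \<forall>t\<in>{0..\<tau>}. norm (P t) \<le> R" by (simp add: bounded_iff)
  then obtain R where R: "\<And>t. t \<in> {0..\<tau>} \<Longrightarrow> norm (P t) \<le> R" by blast
  have "\<xi> t \<in> cball x0 R" if t: "t \<in> {0..\<tau>}" and \<xi>: "solution_on f W u {0..t} \<xi>" "\<xi> 0 = x0" for t \<xi>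
  proof -
    obtain L where L: "L-lipschitz_on {0..t} \<xi>"
      using solution_on_lipschitz[OF \<xi>(1) order_refl f_cont] by auto
    obtain N where N: "negligible N" "\<And>s. s \<in> {0..t} - N \<Longrightarrow>
        \<exists>v. (\<xi> has_vector_derivative v) (at s within {0..t}) \<and> v \<in> (+) (f (\<xi> s) u) ` W"
      using solution_on_derivative[OF \<xi>(1)] by metis
    have "\<bar>\<xi> t - x0\<bar> \<le> matrix_exp (t *\<^sub>R A) *v \<bar>\<xi> 0 - x0\<bar> + integral {0..t} (\<lambda>s. matrix_exp (s *\<^sub>R A) *v c)"
    proof (rule metzler_comparison[where z = "\<lambda>s. \<xi> s - x0", OF metzler_A _ _ N(1)])
      show "(L + 0)-lipschitz_on {0..t} (\<lambda>s. \<xi> s - x0)"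
        by (rule lipschitz_on_diff[OF L lipschitz_on_constant])
      show "0 \<le> t" using t by simp
      fix s assume s: "s \<in> {0..t} - N"
      from N(2)[OF this] obtain \<omega> where \<omega>: "\<omega> \<in> W"
        and d: "(\<xi> has_vector_derivative f (\<xi> s) u + \<omega>) (at s within {0..t})" by blast
      have "\<xi> s \<in> K'" using stay[OF t \<xi>(1)] \<xi>(2) x0 s by auto
      have "sgn ((\<xi> s - x0) $ i) * (f (\<xi> s) u + \<omega>) $ i \<le> (A *v \<bar>\<xi> s - x0\<bar> + c) $ i" for i
      proof -
        let ?s = "sgn ((\<xi> s - x0) $ i)"
        have "?s * (f (\<xi> s) u - f x0 u) $ i \<le> (A *v \<bar>\<xi> s - x0\<bar>) $ i"
          using one_sided_estimate[OF C1 conv \<open>\<xi> s \<in> K'\<close> _ A] x0 KK' by blast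
        moreover have "?s * f x0 u $ i \<le> \<bar>f x0 u $ i\<bar>"
          by (auto simp: sgn_if)
        moreover have "?s * \<omega> $ i \<le> w $ i"
          by (rule perturbation_bound[OF \<omega>]) (simp add: abs_sgn_eq)
        ultimately show ?thesis by (simp add: c_def algebra_simps)
      qed
      moreover have "((\<lambda>s. \<xi> s - x0) has_vector_derivative f (\<xi> s) u + \<omega>) (at s within {0..t})"
        using has_vector_derivative_diff[OF d has_vector_derivative_const] by simp
      ultimately show "\<exists>d. ((\<lambda>s. \<xi> s - x0) has_vector_derivative d) (at s within {0..t}) \<and>
          (\<forall>i. sgn ((\<xi> s - x0) $ i) * d $ i \<le> (A *v \<bar>\<xi> s - x0\<bar> + c) $ i)" by blast
    qed
    then have "\<bar>\<xi> t - x0\<bar> \<le> P t" using \<xi>(2) by (simp add: P_def)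
    then have "norm (\<xi> t - x0) \<le> norm (P t)"
      by (intro norm_le_componentwise_cart) (auto simp: less_eq_vec_def intro: order_trans[OF _ abs_ge_self])
    then show ?thesis using R[OF t] by (simp add: dist_norm norm_minus_commute)
  qed
  then show ?thesis by blast
qed

text \<open>
  The disturbance set \<open>V\<close> is kept variable: \<open>V = W\<close> gives the claim on perturbed solutions, and \<open>V = {0}\<close>
  gives the existence of the unperturbed solution on the whole interval.
\<close>

lemma solution_from_K_continuable:
  assumes t1: "t1 \<in> {0..\<tau>}" and \<xi>: "solution_on f V u {0..t1} \<xi>" "\<xi> 0 \<in> K"
    and V: "0 \<in> V" "V \<subseteq> W"
  shows "continuable_to f V u {0..t1} \<xi> {0..\<tau>}"
proof -
  obtain R where R: "\<And>t \<xi>'. \<lbrakk>t \<in> {0..\<tau>}; solution_on f W u {0..t} \<xi>'; \<xi>' 0 = \<xi> 0\<rbrakk> \<Longrightarrow> \<xi>' t \<in> cball (\<xi> 0) R"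
    using solution_from_K_bounded[OF \<xi>(2)] by blast
  obtain \<delta> where "\<delta> > 0" and \<delta>: "\<And>y t0. y \<in> cball (\<xi> 0) R \<Longrightarrow> \<exists>\<xi>. \<xi> t0 = y \<and> solution_on f {0} u {t0..t0 + \<delta>} \<xi>"
    using uniform_existence_time[OF lip] by metis
  have "bounded V" using V(2) bounded_cbox bounded_subset by blast
  have step: "\<exists>\<eta>. solution_on f V u {0..min \<tau> (t1 + real n * \<delta>)} \<eta> \<and> (\<forall>t\<in>{0..t1}. \<eta> t = \<xi> t)" for n
  proof (induction n)
    case 0
    have "min \<tau> (t1 + real 0 * \<delta>) = t1" using t1 by simp
    then show ?case using \<xi> by (intro exI[of _ \<xi>]) simp
  next
    case (Suc n)
    define b where "b = min \<tau> (t1 + real n * \<delta>)"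
    define c where "c = min \<tau> (t1 + real (Suc n) * \<delta>)"
    have b: "t1 \<le> b" "b \<in> {0..\<tau>}" using t1 \<open>\<delta> > 0\<close> by (auto simp: b_def)
    have c: "b \<le> c" "c \<le> b + \<delta>" using \<open>\<delta> > 0\<close> by (auto simp: b_def c_def algebra_simps)
    obtain \<eta> where \<eta>: "solution_on f V u {0..b} \<eta>" "\<forall>t\<in>{0..t1}. \<eta> t = \<xi> t"
      using Suc.IH by (auto simp: b_def)
    have "\<eta> b \<in> cball (\<xi> 0) R"
      using R[OF b(2) solution_on_mono[OF \<eta>(1) V(2)]] \<eta>(2) t1 by auto
    from \<delta>[OF this, of b] obtain \<zeta> where \<zeta>: "\<zeta> b = \<eta> b" "solution_on f {0} u {b..b + \<delta>} \<zeta>"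
      by blast
    have "solution_on f V u {b..c} \<zeta>"
    proof (rule solution_on_mono)
      show "solution_on f {0} u {b..c} \<zeta>"
        by (rule solution_on_subset[OF \<zeta>(2)]) (use c is_interval_cc in auto)
    qed (use V in simp)
    then have "solution_on f V u {0..c} (\<lambda>t. if t \<le> b then \<eta> t else \<zeta> t)"
      using solution_on_concat[OF \<eta>(1) _ _ f_cont \<open>bounded V\<close>] \<zeta>(1) by simp
    then show ?case
      unfolding c_def[symmetric] using \<eta>(2) b(1)
      by (intro exI[of _ "\<lambda>t. if t \<le> b then \<eta> t else \<zeta> t"]) auto
  qed
  obtain n :: nat where "\<tau> < real n * \<delta>"
    using reals_Archimedean3[OF \<open>\<delta> > 0\<close>] by blast
  then have "min \<tau> (t1 + real n * \<delta>) = \<tau>" using t1 by auto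
  with step[of n] show ?thesis by (auto simp: continuable_to_def)
qed

lemma zero_in_W: "0 \<in> W"
  using w by (auto simp: mem_box_cart less_eq_vec_def)

lemma general_solution_on:
  assumes p: "p \<in> K"
  shows "\<exists>\<eta>. solution_on f {0} u {0..\<tau>} \<eta> \<and> \<eta> 0 = p \<and> {0..\<tau>} \<subseteq> dom (general_solution f u p) \<and>
     the (general_solution f u p \<tau>) = \<eta> \<tau>"
proof -
  have "solution_on f {0} u {0..0} (\<lambda>_. p)"
    by (rule solution_on_lipschitzI[where N = "{0}"])
       (use lipschitz_on_constant is_interval_cc[of 0 0] in auto)
  then have "continuable_to f {0} u {0..0} (\<lambda>_. p) {0..\<tau>}"
    using \<tau> p zero_in_W by (intro solution_from_K_continuable) auto
  then obtain \<eta> where \<eta>: "solution_on f {0} u {0..\<tau>} \<eta>" "\<eta> 0 = p"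
    by (auto simp: continuable_to_def)
  then show ?thesis
    using general_solution_extends[OF lip \<eta>(1)] \<tau> by auto
qed

lemma solution_difference_bound:
  assumes \<xi>: "solution_on f W u {0..\<tau>} \<xi>" "\<xi> 0 \<in> K" and \<eta>: "solution_on f {0} u {0..\<tau>} \<eta>" "\<eta> 0 \<in> K"
  shows "\<bar>\<xi> \<tau> - \<eta> \<tau>\<bar> \<le> matrix_exp (\<tau> *\<^sub>R A) *v \<bar>\<xi> 0 - \<eta> 0\<bar> + integral {0..\<tau>} (\<lambda>s. matrix_exp (s *\<^sub>R A) *v w)"
proof -
  obtain L where L: "L-lipschitz_on {0..\<tau>} \<xi>"
    using solution_on_lipschitz[OF \<xi>(1) order_refl f_cont] by auto
  obtain M where M: "M-lipschitz_on {0..\<tau>} \<eta>"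
    using solution_on_lipschitz[OF \<eta>(1) order_refl f_cont] by auto
  have \<eta>W: "solution_on f W u {0..\<tau>} \<eta>"
    using solution_on_mono[OF \<eta>(1)] zero_in_W by simp
  obtain N1 where N1: "negligible N1" "\<And>s. s \<in> {0..\<tau>} - N1 \<Longrightarrow>
      \<exists>v. (\<xi> has_vector_derivative v) (at s within {0..\<tau>}) \<and> v \<in> (+) (f (\<xi> s) u) ` W"
    using solution_on_derivative[OF \<xi>(1)] by metis
  obtain N2 where N2: "negligible N2" "\<And>s. s \<in> {0..\<tau>} - N2 \<Longrightarrow>
      (\<eta> has_vector_derivative f (\<eta> s) u) (at s within {0..\<tau>})"
    using unperturbed_solution_derivative[OF \<eta>(1)] by metis
  show ?thesis
  proof (rule metzler_comparison[where z = "\<lambda>s. \<xi> s - \<eta> s" and N = "N1 \<union> N2", OF metzler_A])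
    show "(L + M)-lipschitz_on {0..\<tau>} (\<lambda>s. \<xi> s - \<eta> s)"
      by (rule lipschitz_on_diff[OF L M])
    show "0 \<le> \<tau>" "negligible (N1 \<union> N2)" using \<tau> N1 N2 by auto
    fix s assume s: "s \<in> {0..\<tau>} - (N1 \<union> N2)"
    then have "s \<in> {0..\<tau>} - N1" by blast
    from N1(2)[OF this] obtain \<omega> where \<omega>: "\<omega> \<in> W"
      and d: "(\<xi> has_vector_derivative f (\<xi> s) u + \<omega>) (at s within {0..\<tau>})" by blast
    have K': "\<xi> s \<in> K'" "\<eta> s \<in> K'"
      using stay[of \<tau>, OF _ \<xi>] stay[of \<tau>, OF _ \<eta>W \<eta>(2)] s \<tau> by auto
    have "sgn ((\<xi> s - \<eta> s) $ i) * (f (\<xi> s) u + \<omega> - f (\<eta> s) u) $ i \<le> (A *v \<bar>\<xi> s - \<eta> s\<bar> + w) $ i" for i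
    proof -
      let ?s = "sgn ((\<xi> s - \<eta> s) $ i)"
      have "?s * (f (\<xi> s) u - f (\<eta> s) u) $ i \<le> (A *v \<bar>\<xi> s - \<eta> s\<bar>) $ i"
        by (rule one_sided_estimate[OF C1 conv K' A])
      moreover have "?s * \<omega> $ i \<le> w $ i"
        by (rule perturbation_bound[OF \<omega>]) (simp add: abs_sgn_eq)
      ultimately show ?thesis by (simp add: algebra_simps)
    qed
    moreover have "((\<lambda>s. \<xi> s - \<eta> s) has_vector_derivative f (\<xi> s) u + \<omega> - f (\<eta> s) u) (at s within {0..\<tau>})"
      using has_vector_derivative_diff[OF d N2(2)] s by blast
    ultimately show "\<exists>d. ((\<lambda>s. \<xi> s - \<eta> s) has_vector_derivative d) (at s within {0..\<tau>}) \<and>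
        (\<forall>i. sgn ((\<xi> s - \<eta> s) $ i) * d $ i \<le> (A *v \<bar>\<xi> s - \<eta> s\<bar> + w) $ i)" by blast
  qed
qed

lemma growth_integral_nonneg: "integral {0..\<tau>} (\<lambda>s. matrix_exp (s *\<^sub>R A) *v w) \<ge> 0"
proof -
  have c: "continuous_on {0..\<tau>} (\<lambda>s. matrix_exp (s *\<^sub>R A) *v w)"
    by (rule bounded_bilinear.continuous_on[OF bounded_bilinear_matrix_vector_mult continuous_on_matrix_exp continuous_on_const])
  have nn: "matrix_exp (s *\<^sub>R A) *v w \<ge> 0" if "s \<in> {0..\<tau>}" for s
    using that by (intro matrix_vector_mult_nonneg matrix_exp_nonneg_metzler metzler_A w) auto
  have "integral {0..\<tau>} (\<lambda>s. matrix_exp (s *\<^sub>R A) *v w) $ i \<ge> 0" for i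
  proof -
    have "integral {0..\<tau>} (\<lambda>s. matrix_exp (s *\<^sub>R A) *v w) $ i = integral {0..\<tau>} (\<lambda>s. (matrix_exp (s *\<^sub>R A) *v w) $ i)"
      using integral_linear[OF integrable_continuous_real[OF c] bounded_linear_vec_nth] by (simp add: o_def)
    also have "\<dots> \<ge> 0"
      using nn by (intro integral_nonneg integrable_continuous_real
          bounded_linear.continuous_on[OF bounded_linear_vec_nth c]) (auto simp: less_eq_vec_def)
    finally show ?thesis .
  qed
  then show ?thesis by (simp add: less_eq_vec_def)
qed

end

theorem mainTheorem8:
  fixes \<tau> :: real
    and U U' :: "(real^'m) set"
    and f :: "real^'n \<Rightarrow> real^'m \<Rightarrow> real^'n"
    and w :: "real^'n"
    and W K K' :: "(real^'n) set"
    and L :: "real^'m \<Rightarrow> real^'n^'n"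
  assumes "\<tau> > 0"
    and "U \<noteq> {}"
    and "\<And>u. u \<in> U \<Longrightarrow> local_lipschitz {u} UNIV (\<lambda>v x. f x v)"
    and "w \<ge> 0"
    and "W = cbox (- w) w"
    and "U' \<subseteq> U"
    and "\<And>u. u \<in> U' \<Longrightarrow> continuously_differentiable (\<lambda>x. f x u)"
    and "K \<subseteq> K'"
    and "K' \<noteq> {}"
    and "convex K'"
    and "\<And>u \<tau>' \<xi> t. \<lbrakk>u \<in> U'; \<tau>' \<in> {0..\<tau>}; solution_on f W u {0..\<tau>'} \<xi>; \<xi> 0 \<in> K; t \<in> {0..\<tau>'}\<rbrakk>
           \<Longrightarrow> \<xi> t \<in> K'"
    and "\<And>x u i j. \<lbrakk>x \<in> K'; u \<in> U'\<rbrakk> \<Longrightarrow>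
           L u $ i $ j \<ge> (if i = j then partial_deriv j (\<lambda>y. f y u $ i) x
                          else \<bar>partial_deriv j (\<lambda>y. f y u $ i) x\<bar>)"
  shows "(\<forall>u\<in>U'. \<forall>\<tau>'\<in>{0..\<tau>}. \<forall>\<xi>. solution_on f W u {0..\<tau>'} \<xi> \<and> \<xi> 0 \<in> K \<longrightarrow>
            continuable_to f W u {0..\<tau>'} \<xi> {0..\<tau>}) \<and>
         growth_bound \<tau> f W K U'
           (\<lambda>r u. matrix_exp (\<tau> *\<^sub>R L u) *v r
                  + integral {0..\<tau>} (\<lambda>s. matrix_exp (s *\<^sub>R L u) *v w))"
proof -
  have setting: "reach_setting f u w K K' (L u) \<tau>" if u: "u \<in> U'" for u
  proof
    show "local_lipschitz {u} UNIV (\<lambda>v x. f x v)" using assms(3,6) u by blast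
    show "\<xi> t \<in> K'" if "\<tau>' \<in> {0..\<tau>}" "solution_on f (cbox (- w) w) u {0..\<tau>'} \<xi>" "\<xi> 0 \<in> K" "t \<in> {0..\<tau>'}"
      for \<tau>' \<xi> t
      using assms(11)[OF u that(1)] that assms(5) by blast
    show "L u $ i $ j \<ge> (if i = j then partial_deriv j (\<lambda>y. f y u $ i) x
        else \<bar>partial_deriv j (\<lambda>y. f y u $ i) x\<bar>)" if "x \<in> K'" for x i j
      by (rule assms(12)[OF that u])
  qed (use assms u in auto)
  let ?\<beta> = "\<lambda>r u. matrix_exp (\<tau> *\<^sub>R L u) *v r + integral {0..\<tau>} (\<lambda>s. matrix_exp (s *\<^sub>R L u) *v w)"
  have E: "matrix_exp (\<tau> *\<^sub>R L u) *v r \<ge> 0" if "u \<in> U'" "r \<ge> 0" for u r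
    using reach_setting.metzler_A[OF setting[OF that(1)]] that(2) \<open>\<tau> > 0\<close>
    by (intro matrix_vector_mult_nonneg matrix_exp_nonneg_metzler) auto
  have "continuable_to f W u {0..\<tau>'} \<xi> {0..\<tau>}"
    if "u \<in> U'" "\<tau>' \<in> {0..\<tau>}" "solution_on f W u {0..\<tau>'} \<xi>" "\<xi> 0 \<in> K" for u \<tau>' \<xi>
    using reach_setting.solution_from_K_continuable[OF setting[OF that(1)] that(2-4)]
      reach_setting.zero_in_W[OF setting[OF that(1)]] \<open>W = cbox (- w) w\<close> by simp
  moreover have "growth_bound \<tau> f W K U' ?\<beta>"
    unfolding growth_bound_def
  proof (intro conjI ballI allI impI)
    fix u r assume "u \<in> U'" "r \<ge> (0 :: real^'n)"
    then show "?\<beta> r u \<ge> 0"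
      using E reach_setting.growth_integral_nonneg[OF setting] by simp
  next
    fix u and r' r :: "real^'n" assume "u \<in> U'" "0 \<le> r'" "r' \<le> r"
    then have "matrix_exp (\<tau> *\<^sub>R L u) *v (r - r') \<ge> 0" by (intro E) auto
    then show "?\<beta> r' u \<le> ?\<beta> r u" by (simp add: matrix_vector_mult_diff_distrib)
  next
    fix u p assume "u \<in> U'" "p \<in> K"
    then show "{0..\<tau>} \<subseteq> dom (general_solution f u p)"
      using reach_setting.general_solution_on[OF setting] by blast
  next
    fix u \<xi> p assume u: "u \<in> U'" and p: "p \<in> K" and \<xi>: "solution_on f W u {0..\<tau>} \<xi> \<and> \<xi> 0 \<in> K"
    obtain \<eta> where "solution_on f {0} u {0..\<tau>} \<eta>" "\<eta> 0 = p" "the (general_solution f u p \<tau>) = \<eta> \<tau>"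
      using reach_setting.general_solution_on[OF setting[OF u] p] by blast
    then show "\<bar>\<xi> \<tau> - the (general_solution f u p \<tau>)\<bar> \<le> ?\<beta> \<bar>\<xi> 0 - p\<bar> u"
      using reach_setting.solution_difference_bound[OF setting[OF u]] \<xi> p \<open>W = cbox (- w) w\<close> by auto
  qed
  ultimately show ?thesis by blast
qed

end
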